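(* Let $G$ be a simple graph such that $G^c$ is a forest. Then $I(G)$ has homological linear quotients, i.e. $\mathrm{HS}_k(I(G))$ has linear quotients for every $k\ge0$.
   Context: $I(G)$ is the edge ideal, generated by $x_ix_j$ for edges $\{i,j\}$; $G^c$ is the complementary graph. A monomial ideal has linear quotients if some ordering $u_1,\dots,u_m$ of its minimal monomial generators makes every $(u_1,\dots,u_{i-1}):u_i$ generated by variables. $\mathrm{HS}_k(I)$ is the monomial ideal generated by $\mathbf x^{\mathbf a}$ for the $k$th multigraded shifts $\mathbf a$ of $I$ in its minimal multigraded free resolution; the zero ideal is regarded as having linear quotients. *)

theory Defs
  imports Main "HOL-Library.Poly_Mapping"
begin

text \<open>Polynomials in the variables x_0, x_1, ... over a field 'k:
  finitely supported maps from exponent vectors (nat =>0 nat) to coefficients.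
  The polynomial ring S = K[x_0..x_(n-1)] is the set of those polynomials all of whose
  monomials only involve variables < n.  A graph on n vertices has vertex set {0..<n}.\<close>

type_synonym 'k mpoly = "(nat \<Rightarrow>\<^sub>0 nat) \<Rightarrow>\<^sub>0 'k"

definition mono :: "(nat \<Rightarrow>\<^sub>0 nat) \<Rightarrow> 'k::comm_semiring_1 mpoly" where
  "mono a = Poly_Mapping.single a 1"

definition var :: "nat \<Rightarrow> 'k::comm_semiring_1 mpoly" where
  "var v = mono (Poly_Mapping.single v 1)"

definition exp_le :: "(nat \<Rightarrow>\<^sub>0 nat) \<Rightarrow> (nat \<Rightarrow>\<^sub>0 nat) \<Rightarrow> bool" where
  "exp_le a b \<longleftrightarrow> (\<forall>v. Poly_Mapping.lookup a v \<le> Poly_Mapping.lookup b v)"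

definition in_S :: "nat \<Rightarrow> 'k::comm_semiring_1 mpoly \<Rightarrow> bool" where
  "in_S n p \<longleftrightarrow> (\<forall>a \<in> Poly_Mapping.keys p. Poly_Mapping.keys a \<subseteq> {..<n})"

definition ideal_gen :: "nat \<Rightarrow> 'k::comm_semiring_1 mpoly set \<Rightarrow> 'k mpoly set" where
  "ideal_gen n B = {p. \<exists>F c. finite F \<and> F \<subseteq> B \<and> (\<forall>b\<in>F. in_S n (c b)) \<and> p = (\<Sum>b\<in>F. c b * b)}"

definition simple_graph :: "nat \<Rightarrow> (nat \<Rightarrow> nat \<Rightarrow> bool) \<Rightarrow> bool" where
  "simple_graph n E \<longleftrightarrow> (\<forall>u v. E u v \<longrightarrow> u < n \<and> v < n \<and> u \<noteq> v \<and> E v u)"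

definition complement_graph :: "nat \<Rightarrow> (nat \<Rightarrow> nat \<Rightarrow> bool) \<Rightarrow> nat \<Rightarrow> nat \<Rightarrow> bool" where
  "complement_graph n E u v \<longleftrightarrow> u < n \<and> v < n \<and> u \<noteq> v \<and> \<not> E u v"

definition is_cycle :: "nat \<Rightarrow> (nat \<Rightarrow> nat \<Rightarrow> bool) \<Rightarrow> nat list \<Rightarrow> bool" where
  "is_cycle n E cs \<longleftrightarrow> length cs \<ge> 3 \<and> distinct cs \<and> set cs \<subseteq> {..<n}
     \<and> (\<forall>i. Suc i < length cs \<longrightarrow> E (cs ! i) (cs ! Suc i))
     \<and> E (last cs) (hd cs)"

definition forest :: "nat \<Rightarrow> (nat \<Rightarrow> nat \<Rightarrow> bool) \<Rightarrow> bool" where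
  "forest n E \<longleftrightarrow> \<not> (\<exists>cs. is_cycle n E cs)"

definition edge_ideal :: "nat \<Rightarrow> (nat \<Rightarrow> nat \<Rightarrow> bool) \<Rightarrow> 'k::comm_semiring_1 mpoly set" where
  "edge_ideal n E = ideal_gen n {var i * var j | i j. i < n \<and> j < n \<and> E i j}"

text \<open>A finite multigraded free resolution of an ideal I of S:
  F_i = direct sum over q < rk i of S(-sh i q); differential d_i : F_i \<rightarrow> F_(i-1) (i \<ge> 1)
  is given by the matrix dif i (entry dif i p q for row p < rk (i-1), column q < rk i);
  the augmentation F_0 \<rightarrow> I sends the basis vector e_q to aug q.\<close>
declare [[typedef_overloaded]]
record ('k::zero) resolution =
  rk :: "nat \<Rightarrow> nat"
  sh :: "nat \<Rightarrow> nat \<Rightarrow> (nat \<Rightarrow>\<^sub>0 nat)"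
  dif :: "nat \<Rightarrow> nat \<Rightarrow> nat \<Rightarrow> 'k mpoly"
  aug :: "nat \<Rightarrow> 'k mpoly"

definition vecs :: "nat \<Rightarrow> nat \<Rightarrow> (nat \<Rightarrow> 'k::comm_semiring_1 mpoly) set" where
  "vecs n r = {v. (\<forall>j. in_S n (v j)) \<and> (\<forall>j. r \<le> j \<longrightarrow> v j = 0)}"

definition apply_mat :: "nat \<Rightarrow> (nat \<Rightarrow> nat \<Rightarrow> 'k::comm_semiring_1 mpoly) \<Rightarrow> (nat \<Rightarrow> 'k mpoly) \<Rightarrow> nat \<Rightarrow> 'k mpoly" where
  "apply_mat r D v = (\<lambda>p. \<Sum>q<r. D p q * v q)"

definition min_free_res :: "nat \<Rightarrow> 'k::field mpoly set \<Rightarrow> 'k resolution \<Rightarrow> bool" where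
  "min_free_res n I R \<longleftrightarrow>
     \<comment> \<open>finite length\<close>
     (\<exists>N. \<forall>i>N. rk R i = 0)
   \<and> (\<forall>i q. Poly_Mapping.keys (sh R i q) \<subseteq> {..<n})
     \<comment> \<open>matrices have the right size\<close>
   \<and> (\<forall>i p q. 1 \<le> i \<longrightarrow> (rk R (i - 1) \<le> p \<or> rk R i \<le> q) \<longrightarrow> dif R i p q = 0)
     \<comment> \<open>differentials are multigraded (homogeneous of degree 0)\<close>
   \<and> (\<forall>i p q. 1 \<le> i \<longrightarrow> dif R i p q = 0 \<or>
        (exp_le (sh R (i - 1) p) (sh R i q) \<and>
         (\<exists>c. c \<noteq> 0 \<and> dif R i p q = Poly_Mapping.single (sh R i q - sh R (i - 1) p) c)))
     \<comment> \<open>minimality: no entry of a differential is a unit\<close>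
   \<and> (\<forall>i p q. 1 \<le> i \<longrightarrow> dif R i p q \<noteq> 0 \<longrightarrow> sh R (i - 1) p \<noteq> sh R i q)
     \<comment> \<open>augmentation F_0 \<rightarrow> I is multigraded\<close>
   \<and> (\<forall>q. rk R 0 \<le> q \<longrightarrow> aug R q = 0)
   \<and> (\<forall>q. q < rk R 0 \<longrightarrow> (\<exists>c. c \<noteq> 0 \<and> aug R q = Poly_Mapping.single (sh R 0 q) c))
     \<comment> \<open>exactness: augmentation onto I\<close>
   \<and> {(\<Sum>q<rk R 0. aug R q * v q) | v. v \<in> vecs n (rk R 0)} = I
     \<comment> \<open>exactness at F_0\<close>
   \<and> {v \<in> vecs n (rk R 0). (\<Sum>q<rk R 0. aug R q * v q) = 0}
       = apply_mat (rk R 1) (dif R 1) ` vecs n (rk R 1)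
     \<comment> \<open>exactness at F_i, i \<ge> 1\<close>
   \<and> (\<forall>i\<ge>1. {v \<in> vecs n (rk R i). apply_mat (rk R i) (dif R i) v = (\<lambda>_. 0)}
       = apply_mat (rk R (Suc i)) (dif R (Suc i)) ` vecs n (rk R (Suc i)))"

text \<open>k-th homological shift ideal: generated by x^a for the k-th multigraded shifts a
  of I in its minimal multigraded free resolution (these do not depend on the choice
  of minimal resolution).\<close>
definition HS :: "nat \<Rightarrow> nat \<Rightarrow> 'k::field mpoly set \<Rightarrow> 'k mpoly set" where
  "HS n k I = ideal_gen n {mono a | a. \<exists>R q. min_free_res n I R \<and> q < rk R k \<and> a = sh R k q}"

definition mon_gens :: "nat \<Rightarrow> 'k::field mpoly set \<Rightarrow> (nat \<Rightarrow>\<^sub>0 nat) set" where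
  "mon_gens n J = {a. Poly_Mapping.keys a \<subseteq> {..<n} \<and> mono a \<in> J}"

definition min_mon_gens :: "nat \<Rightarrow> 'k::field mpoly set \<Rightarrow> (nat \<Rightarrow>\<^sub>0 nat) set" where
  "min_mon_gens n J = {a \<in> mon_gens n J. \<forall>b \<in> mon_gens n J. exp_le b a \<longrightarrow> b = a}"

definition colon :: "nat \<Rightarrow> 'k::field mpoly set \<Rightarrow> 'k mpoly \<Rightarrow> 'k mpoly set" where
  "colon n J f = {g. in_S n g \<and> g * f \<in> J}"

text \<open>linear quotients (of a monomial ideal J; the zero ideal has linear quotients)\<close>
definition linear_quotients :: "nat \<Rightarrow> 'k::field mpoly set \<Rightarrow> bool" where
  "linear_quotients n J \<longleftrightarrow> (\<exists>us. distinct us \<and> set us = min_mon_gens n J \<and>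
     (\<forall>i < length us. \<exists>V \<subseteq> {..<n}.
        colon n (ideal_gen n (mono ` set (take i us))) (mono (us ! i)) = ideal_gen n ((var :: nat \<Rightarrow> 'k mpoly) ` V)))"

end

theory Submission
  imports Defs
begin

text \<open>
  Write \<open>H\<close> for the forest complementary to \<open>G\<close>. Setting all variables to \<open>1\<close> turns a minimal
  multigraded resolution of \<open>S/I(G)\<close> into a complex of vector spaces with graded bases, in which the
  basis elements of degree below a fixed \<open>x\<^sup>b\<close> span an exact subcomplex as soon as \<open>x\<^sup>b \<in> I(G)\<close>.
  By minimality, \<open>x\<^sup>b\<close> is a shift at level \<open>i \<ge> 1\<close> iff the union of the subcomplexes of degrees properly
  dividing \<open>x\<^sup>b\<close> has homology at level \<open>i - 1\<close>. Shifts are squarefree, and Mayer-Vietoris arguments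
  that split off a vertex of degree at most one show that the shifts at level \<open>k + 1\<close>, i.e. the \<open>k\<close>th
  shifts of \<open>I(G)\<close>, are exactly the sets \<open>A\<close> of \<open>k + 2\<close> vertices for which \<open>H[A]\<close> is disconnected.
  No resolution has to be constructed: without one, the homological shift ideals vanish.

  The sets are ordered recursively. For a vertex \<open>w\<close> whose only possible neighbour is \<open>u\<close>, take
  first the sets containing \<open>w\<close> but not \<open>u\<close>, then those containing both, then those avoiding \<open>w\<close>.
  A set of the second kind exchanges \<open>u\<close>, and one of the third kind takes in \<open>w\<close>, to land in the
  first kind, where \<open>w\<close> is isolated and disconnectedness is automatic.
\<close>

section \<open>Disconnected vertex sets\<close>

text \<open>Separations take the place of paths; with both parts nonempty, the empty set and
  singletons count as connected.\<close>

definition disconnected_on :: "('v \<Rightarrow> 'v \<Rightarrow> bool) \<Rightarrow> 'v set \<Rightarrow> bool" where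
  "disconnected_on H A \<longleftrightarrow> (\<exists>X Y. X \<noteq> {} \<and> Y \<noteq> {} \<and> X \<inter> Y = {} \<and> A = X \<union> Y \<and>
     (\<forall>x\<in>X. \<forall>y\<in>Y. \<not> H x y \<and> \<not> H y x))"

lemma disconnected_onE:
  assumes "disconnected_on H A"
  obtains X Y where "X \<noteq> {}" "Y \<noteq> {}" "X \<inter> Y = {}" "A = X \<union> Y"
    "\<forall>x\<in>X. \<forall>y\<in>Y. \<not> H x y \<and> \<not> H y x"
  using assms unfolding disconnected_on_def by (elim exE conjE)

text \<open>For \<open>H\<close> complementary to \<open>G\<close>, this says that the squarefree
  monomial with support \<open>A\<close> lies in \<open>I(G)\<close>.\<close>

definition has_nonedge :: "('v \<Rightarrow> 'v \<Rightarrow> bool) \<Rightarrow> 'v set \<Rightarrow> bool" where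
  "has_nonedge H A \<longleftrightarrow> (\<exists>u\<in>A. \<exists>v\<in>A. u \<noteq> v \<and> \<not> H u v)"

lemma has_nonedge_mono: "has_nonedge H A \<Longrightarrow> A \<subseteq> B \<Longrightarrow> has_nonedge H B"
  unfolding has_nonedge_def by blast

lemma has_nonedgeI: "u \<in> A \<Longrightarrow> v \<in> A \<Longrightarrow> u \<noteq> v \<Longrightarrow> \<not> H u v \<Longrightarrow> has_nonedge H A"
  unfolding has_nonedge_def by blast

lemma disconnected_on_has_nonedge: "disconnected_on H A \<Longrightarrow> has_nonedge H A"
  unfolding disconnected_on_def has_nonedge_def
  by (metis UnCI disjoint_iff ex_in_conv)

lemma disconnected_on_isolated:
  assumes "w \<in> A" "v \<in> A" "v \<noteq> w" "\<forall>x\<in>A. \<not> H w x \<and> \<not> H x w"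
  shows "disconnected_on H A"
  unfolding disconnected_on_def
  by (rule exI[of _ "{w}"], rule exI[of _ "A - {w}"]) (use assms in auto)

text \<open>In a separation a leaf lies on the side of its neighbour \<open>u\<close>, so it can be
  deleted without emptying that side and put back without creating a crossing edge.\<close>

lemma disconnected_on_leaf:
  assumes w: "w \<in> A" and u: "u \<in> A" "w \<noteq> u" "H w u"
    and leaf: "\<forall>v\<in>A. H w v \<or> H v w \<longrightarrow> v = u"
  shows "disconnected_on H A \<longleftrightarrow> disconnected_on H (A - {w})"
proof
  assume "disconnected_on H A"
  then obtain X Y where XY: "X \<noteq> {}" "Y \<noteq> {}" "X \<inter> Y = {}" "A = X \<union> Y"
    "\<forall>x\<in>X. \<forall>y\<in>Y. \<not> H x y \<and> \<not> H y x"
    by (rule disconnected_onE)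
  have "(w \<in> X \<and> u \<in> X) \<or> (w \<in> Y \<and> u \<in> Y)" using XY w u by blast
  then have "X - {w} \<noteq> {}" "Y - {w} \<noteq> {}" using XY u by blast+
  moreover have "A - {w} = (X - {w}) \<union> (Y - {w})" using XY by blast
  moreover have "(X - {w}) \<inter> (Y - {w}) = {}" using XY by blast
  moreover have "\<forall>x\<in>X - {w}. \<forall>y\<in>Y - {w}. \<not> H x y \<and> \<not> H y x" using XY by blast
  ultimately show "disconnected_on H (A - {w})"
    unfolding disconnected_on_def by metis
next
  \<comment> \<open>The vertex \<open>w\<close> has to join the side containing \<open>u\<close>;
    the sides are interchangeable, so that side is called \<open>X\<close>.\<close>
  have *: "disconnected_on H A" if XY: "X \<noteq> {}" "Y \<noteq> {}" "X \<inter> Y = {}" "A - {w} = X \<union> Y"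
    "\<forall>x\<in>X. \<forall>y\<in>Y. \<not> H x y \<and> \<not> H y x" "u \<in> X" for X Y
  proof -
    have "w \<notin> Y" "u \<notin> Y" "Y \<subseteq> A" using XY by blast+
    then have "\<forall>x\<in>insert w X. \<forall>y\<in>Y. \<not> H x y \<and> \<not> H y x" using XY leaf by blast
    moreover have "insert w X \<inter> Y = {}" "A = insert w X \<union> Y" using XY w \<open>w \<notin> Y\<close> by blast+
    ultimately show ?thesis
      unfolding disconnected_on_def using XY(2) by (metis insert_not_empty)
  qed
  assume "disconnected_on H (A - {w})"
  then obtain X Y where XY: "X \<noteq> {}" "Y \<noteq> {}" "X \<inter> Y = {}" "A - {w} = X \<union> Y"
    "\<forall>x\<in>X. \<forall>y\<in>Y. \<not> H x y \<and> \<not> H y x"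
    by (rule disconnected_onE)
  have "u \<in> X \<or> u \<in> Y" using XY u by blast
  then show "disconnected_on H A"
  proof
    assume "u \<in> X"
    then show ?thesis using *[OF XY] by blast
  next
    assume "u \<in> Y"
    moreover have "Y \<inter> X = {}" "A - {w} = Y \<union> X" "\<forall>x\<in>Y. \<forall>y\<in>X. \<not> H x y \<and> \<not> H y x"
      using XY by auto
    ultimately show ?thesis using *[OF XY(2,1)] by blast
  qed
qed

text \<open>The simplicial complex generated by the facets \<open>A - {v}\<close> with
  \<open>v\<close> in \<open>W\<close>. For \<open>W = A\<close> it is the boundary of the simplex
  on \<open>A\<close>.\<close>

definition facets_at :: "'v set \<Rightarrow> 'v set \<Rightarrow> 'v set set" where
  "facets_at A W = {X. \<exists>v\<in>W. X \<subseteq> A - {v}}"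

lemma facets_at_downward: "X \<in> facets_at A W \<Longrightarrow> Y \<subset> X \<Longrightarrow> Y \<in> facets_at A W"
  unfolding facets_at_def by blast

lemma facets_at_subset_Pow: "facets_at A W \<subseteq> Pow A"
  unfolding facets_at_def by blast

lemma facets_at_insert: "facets_at A (insert v W) = facets_at A W \<union> Pow (A - {v})"
  unfolding facets_at_def by auto

lemma facets_at_inter: "facets_at A W \<inter> Pow (A - {v}) = facets_at (A - {v}) W"
  unfolding facets_at_def by auto

text \<open>\<open>deg1\<close> is the form in which the forest hypothesis enters the combinatorics.
  It ranges over all vertex subsets, so it survives the deletion of vertices.\<close>

locale deg1_graph =
  fixes V :: "nat set" and H :: "nat \<Rightarrow> nat \<Rightarrow> bool"
  assumes finV: "finite V"
    and sym: "H u v \<Longrightarrow> H v u"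
    and irrefl: "\<not> H u u"
    and deg1: "A \<subseteq> V \<Longrightarrow> A \<noteq> {} \<Longrightarrow> \<exists>w\<in>A. \<exists>u. \<forall>v\<in>A. H w v \<longrightarrow> v = u"
begin

abbreviation disc :: "nat set \<Rightarrow> bool" where "disc \<equiv> disconnected_on H"

lemma leaf_disc:
  assumes "w \<in> A" "u \<in> A" "H w u" "\<forall>v\<in>A. H w v \<longrightarrow> v = u"
  shows "disc A \<longleftrightarrow> disc (A - {w})"
  using disconnected_on_leaf[of w A u H] assms sym irrefl by metis

lemma isolated_disc:
  assumes "w \<in> A" "2 \<le> card A" "\<forall>v\<in>A. \<not> H w v"
  shows "disc A"
proof -
  have "\<exists>v\<in>A. v \<noteq> w"
  proof (rule ccontr)
    assume "\<not> ?thesis"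
    then have "A \<subseteq> {w}" by blast
    then have "card A \<le> 1" using card_mono[of "{w}" A] by simp
    then show False using assms by simp
  qed
  then show ?thesis using disconnected_on_isolated[of w A _ H] assms sym by metis
qed

text \<open>The vertex \<open>u\<close> is provided even when \<open>w\<close> is isolated: then
  \<open>A\<close> is disconnected and any other vertex of \<open>A\<close> serves.\<close>

lemma deg1_pair:
  assumes "A \<subseteq> V" "2 \<le> card A"
  shows "\<exists>w\<in>A. \<exists>u\<in>A. w \<noteq> u \<and> (\<forall>v\<in>A. H w v \<longrightarrow> v = u) \<and> (disc A \<or> H w u)"
proof -
  have "A \<noteq> {}" using assms by auto
  then obtain w u where w: "w \<in> A" "\<forall>v\<in>A. H w v \<longrightarrow> v = u" using deg1 assms by meson
  show ?thesis
  proof (cases "u \<in> A \<and> H w u")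
    case True
    then show ?thesis using w irrefl by metis
  next
    case False
    then have iso: "\<forall>v\<in>A. \<not> H w v" using w by blast
    then have "disc A" using isolated_disc w assms by blast
    moreover have "\<exists>v\<in>A. v \<noteq> w"
      using disconnected_on_has_nonedge[OF \<open>disc A\<close>] unfolding has_nonedge_def by metis
    ultimately show ?thesis using w iso by metis
  qed
qed

text \<open>Meant for inductions in which the smaller set must stay disconnected. Deleting a genuine
  leaf guarantees this; deleting an isolated vertex may not, so that is done only when
  \<open>A\<close> has no edges of \<open>H\<close> at all.\<close>

lemma disc_deg1_pair:
  assumes "A \<subseteq> V" "3 \<le> card A" "disc A"
  shows "\<exists>w\<in>A. \<exists>u\<in>A. w \<noteq> u \<and> (\<forall>v\<in>A. H w v \<longrightarrow> v = u) \<and> disc (A - {w})"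
proof (cases "\<exists>a\<in>A. \<exists>b\<in>A. H a b")
  case True
  \<comment> \<open>Among the nonisolated vertices, the vertex supplied by \<open>deg1\<close> must
    have a neighbour.\<close>
  define A' where "A' = {a\<in>A. \<exists>b\<in>A. H a b}"
  have "A' \<noteq> {}" "A' \<subseteq> V" using True assms unfolding A'_def by auto
  then obtain w u where w: "w \<in> A'" "\<forall>v\<in>A'. H w v \<longrightarrow> v = u" using deg1 by meson
  have "\<forall>v\<in>A. H w v \<longrightarrow> v \<in> A'" using w sym unfolding A'_def by blast
  then have 1: "\<forall>v\<in>A. H w v \<longrightarrow> v = u" using w by blast
  then have "w \<in> A" "u \<in> A" "H w u" using w unfolding A'_def by auto
  then show ?thesis using 1 leaf_disc assms irrefl by metis
next
  case False
  obtain w u where wu: "w \<in> A" "u \<in> A" "w \<noteq> u" "\<forall>v\<in>A. H w v \<longrightarrow> v = u"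
    using deg1_pair[of A] assms by auto
  have "2 \<le> card (A - {w})" using assms wu by simp
  then have "disc (A - {w})" using isolated_disc[of u "A - {w}"] False wu by blast
  then show ?thesis using wu by blast
qed

end

section \<open>Complexes with set-valued shifts\<close>

text \<open>The type of shifts is left open, since the same notion serves for exponent vectors and
  for vertex sets.\<close>

definition chains :: "(nat \<Rightarrow> nat) \<Rightarrow> (nat \<Rightarrow> nat \<Rightarrow> 'd) \<Rightarrow> nat \<Rightarrow> 'd set \<Rightarrow> (nat \<Rightarrow> 'k::field) set" where
  "chains r s j B = {x. \<forall>q. x q \<noteq> 0 \<longrightarrow> q < r j \<and> s j q \<in> B}"

definition bdry :: "(nat \<Rightarrow> nat) \<Rightarrow> (nat \<Rightarrow> nat \<Rightarrow> nat \<Rightarrow> 'k::field) \<Rightarrow> nat \<Rightarrow> (nat \<Rightarrow> 'k) \<Rightarrow> nat \<Rightarrow> 'k" where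
  "bdry r D j x = (\<lambda>p. \<Sum>q<r j. D j p q * x q)"

lemma bdry_add: "bdry r D j (\<lambda>q. x q + y q) = (\<lambda>p. bdry r D j x p + bdry r D j y p)"
  unfolding bdry_def by (simp add: algebra_simps sum.distrib)

lemma bdry_diff: "bdry r D j (\<lambda>q. x q - y q) = (\<lambda>p. bdry r D j x p - bdry r D j y p)"
  unfolding bdry_def by (simp add: algebra_simps sum_subtractf)

lemma chains_mono: "B \<subseteq> B' \<Longrightarrow> chains r s j B \<subseteq> chains r s j B'"
  unfolding chains_def by blast

lemma chains_add: "x \<in> chains r s j B \<Longrightarrow> y \<in> chains r s j B \<Longrightarrow> (\<lambda>q. x q + y q) \<in> chains r s j B"
  unfolding chains_def by (auto, metis add_0, metis add_0)

lemma chains_diff: "x \<in> chains r s j B \<Longrightarrow> y \<in> chains r s j B \<Longrightarrow> (\<lambda>q. x q - y q) \<in> chains r s j B"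
  unfolding chains_def by (auto, metis diff_self, metis diff_self)

lemma chains_inter: "x \<in> chains r s j B \<Longrightarrow> x \<in> chains r s j B' \<Longrightarrow> x \<in> chains r s j (B \<inter> B')"
  unfolding chains_def by auto

lemma chains_union:
  assumes "x \<in> chains r s j (B \<union> B')"
  obtains y z where "y \<in> chains r s j B" "z \<in> chains r s j B'" "x = (\<lambda>q. y q + z q)"
proof (rule that)
  show "(\<lambda>q. if s j q \<in> B then x q else 0) \<in> chains r s j B"
    "(\<lambda>q. if s j q \<in> B then 0 else x q) \<in> chains r s j B'"
    using assms unfolding chains_def by auto
qed auto

text \<open>A minimal resolution of \<open>S/I(G)\<close> with all variables set to 1 and squarefree
  shifts recorded by their supports. \<open>strict\<close> encodes minimality. \<open>exact\<close>
  is exactness in one squarefree degree; at level 0 it holds only for degrees in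
  \<open>I(G)\<close>.\<close>

locale set_frame = deg1_graph +
  fixes r :: "nat \<Rightarrow> nat" and s :: "nat \<Rightarrow> nat \<Rightarrow> nat set" and D :: "nat \<Rightarrow> nat \<Rightarrow> nat \<Rightarrow> 'k::field"
  assumes r0: "r 0 = 1" and s0: "s 0 q = {}" and D0: "D 0 p q = 0"
    and sV: "q < r j \<Longrightarrow> s j q \<subseteq> V"
    and strict: "D (Suc j) p q \<noteq> 0 \<Longrightarrow> q < r (Suc j) \<Longrightarrow> p < r j \<and> s j p \<subset> s (Suc j) q"
    and dd: "x \<in> chains r s (Suc j) UNIV \<Longrightarrow> bdry r D j (bdry r D (Suc j) x) = (\<lambda>_. 0)"
    and exact: "A \<subseteq> V \<Longrightarrow> x \<in> chains r s j (Pow A) \<Longrightarrow> bdry r D j x = (\<lambda>_. 0) \<Longrightarrow> 1 \<le> j \<or> has_nonedge H A \<Longrightarrow>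
       \<exists>y\<in>chains r s (Suc j) (Pow A). bdry r D (Suc j) y = x"
    and s1: "q < r 1 \<Longrightarrow> has_nonedge H (s 1 q)"
begin

section \<open>Homology of subcomplexes and Mayer-Vietoris\<close>

abbreviation Ch :: "nat \<Rightarrow> nat set set \<Rightarrow> (nat \<Rightarrow> 'k) set" where "Ch \<equiv> chains r s"
abbreviation bd :: "nat \<Rightarrow> (nat \<Rightarrow> 'k) \<Rightarrow> nat \<Rightarrow> 'k" where "bd \<equiv> bdry r D"

definition acyc :: "nat \<Rightarrow> nat set set \<Rightarrow> bool" where
  "acyc j B \<longleftrightarrow> (\<forall>x\<in>Ch j B. bd j x = (\<lambda>_. 0) \<longrightarrow> (\<exists>y\<in>Ch (Suc j) B. bd (Suc j) y = x))"

lemma bd_0: "bd 0 x = (\<lambda>_. 0)"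
  unfolding bdry_def by (simp add: D0)

lemma bd_nonzero:
  assumes "bd (Suc j) x p \<noteq> 0"
  shows "\<exists>q<r (Suc j). x q \<noteq> 0 \<and> p < r j \<and> s j p \<subset> s (Suc j) q \<and> D (Suc j) p q \<noteq> 0"
proof -
  obtain q where "q < r (Suc j)" "D (Suc j) p q * x q \<noteq> 0"
    using assms unfolding bdry_def by (metis (no_types, lifting) sum.neutral lessThan_iff)
  then show ?thesis using strict[of j p q] by (intro exI[of _ q]) auto
qed

lemma bd_Ch:
  assumes "x \<in> Ch (Suc j) B" "\<And>X Y. X \<in> B \<Longrightarrow> Y \<subset> X \<Longrightarrow> Y \<in> B'"
  shows "bd (Suc j) x \<in> Ch j B'"
proof -
  have "p < r j \<and> s j p \<in> B'" if "bd (Suc j) x p \<noteq> 0" for p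
    using bd_nonzero[OF that] assms unfolding chains_def by blast
  then show ?thesis unfolding chains_def by blast
qed

lemma bd_bd: "x \<in> Ch (Suc j) B \<Longrightarrow> bd j (bd (Suc j) x) = (\<lambda>_. 0)"
  using dd subsetD[OF chains_mono[OF subset_UNIV]] by metis

text \<open>One stretch of the long exact sequence: the homology of the union at level
  \<open>Suc j\<close> sits between that of the two parts at the same level and that of the
  intersection at level \<open>j\<close>.\<close>

lemma mayer_vietoris:
  assumes "\<And>X Y. X \<in> B \<Longrightarrow> Y \<subset> X \<Longrightarrow> Y \<in> B" "\<And>X Y. X \<in> B' \<Longrightarrow> Y \<subset> X \<Longrightarrow> Y \<in> B'"
    and a: "acyc (Suc j) B" "acyc (Suc j) B'" "acyc j (B \<inter> B')"
  shows "acyc (Suc j) (B \<union> B')"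
  unfolding acyc_def
proof (intro ballI impI)
  fix x assume "x \<in> Ch (Suc j) (B \<union> B')" and x0: "bd (Suc j) x = (\<lambda>_. 0)"
  then obtain y z where yz: "y \<in> Ch (Suc j) B" "z \<in> Ch (Suc j) B'" "x = (\<lambda>q. y q + z q)"
    using chains_union by blast
  have e: "bd (Suc j) y p + bd (Suc j) z p = 0" for p
    using x0 yz(3) bdry_add by metis
  have "bd (Suc j) y \<in> Ch j B" using bd_Ch yz assms by blast
  moreover have "bd (Suc j) z \<in> Ch j B'" using bd_Ch yz assms by blast
  then have "bd (Suc j) y \<in> Ch j B'" using e unfolding chains_def
    by (smt (verit, best) add.right_neutral mem_Collect_eq)
  ultimately have "bd (Suc j) y \<in> Ch j (B \<inter> B')" by (rule chains_inter)
  moreover have "bd j (bd (Suc j) y) = (\<lambda>_. 0)"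
    by (rule bd_bd[OF yz(1)])
  ultimately obtain t where t: "t \<in> Ch (Suc j) (B \<inter> B')" "bd (Suc j) t = bd (Suc j) y"
    using a(3) unfolding acyc_def by blast
  have "t \<in> Ch (Suc j) B" "t \<in> Ch (Suc j) B'"
    by (rule subsetD[OF chains_mono t(1)], simp)+
  \<comment> \<open>Correcting both summands by \<open>t\<close> turns them into cycles without
    changing their sum.\<close>
  have "(\<lambda>q. y q - t q) \<in> Ch (Suc j) B" using yz \<open>t \<in> Ch (Suc j) B\<close> chains_diff by blast
  moreover have "bd (Suc j) (\<lambda>q. y q - t q) = (\<lambda>_. 0)" using t by (simp add: bdry_diff)
  ultimately obtain f where f: "f \<in> Ch (Suc (Suc j)) B" "bd (Suc (Suc j)) f = (\<lambda>q. y q - t q)"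
    using a(1) unfolding acyc_def by blast
  have "(\<lambda>q. z q + t q) \<in> Ch (Suc j) B'" using yz \<open>t \<in> Ch (Suc j) B'\<close> chains_add by blast
  moreover have "bd (Suc j) (\<lambda>q. z q + t q) = (\<lambda>_. 0)" using t e by (simp add: bdry_add add.commute)
  ultimately obtain g where g: "g \<in> Ch (Suc (Suc j)) B'" "bd (Suc (Suc j)) g = (\<lambda>q. z q + t q)"
    using a(2) unfolding acyc_def by blast
  have "(\<lambda>q. f q + g q) \<in> Ch (Suc (Suc j)) (B \<union> B')"
    using f g chains_add chains_mono[of B "B \<union> B'"] chains_mono[of B' "B \<union> B'"] by blast
  moreover have "bd (Suc (Suc j)) (\<lambda>q. f q + g q) = x"
    using f g yz by (simp add: bdry_add)
  ultimately show "\<exists>y\<in>Ch (Suc (Suc j)) (B \<union> B'). bd (Suc (Suc j)) y = x" by blast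
qed

text \<open>The next stretch of the sequence: a cycle on the intersection bounds in both parts, and
  the difference of the two bounding chains is a cycle on the union.\<close>

lemma mayer_vietoris_converse:
  assumes down: "\<And>X Y. X \<in> B \<Longrightarrow> Y \<subset> X \<Longrightarrow> Y \<in> B" "\<And>X Y. X \<in> B' \<Longrightarrow> Y \<subset> X \<Longrightarrow> Y \<in> B'"
    and a: "acyc j B" "acyc j B'" "acyc (Suc j) (B \<union> B')"
  shows "acyc j (B \<inter> B')"
  unfolding acyc_def
proof (intro ballI impI)
  fix z assume z: "z \<in> Ch j (B \<inter> B')" and z0: "bd j z = (\<lambda>_. 0)"
  have "z \<in> Ch j B" "z \<in> Ch j B'"
    by (rule subsetD[OF chains_mono z], simp)+
  then obtain y1 y2 where y: "y1 \<in> Ch (Suc j) B" "bd (Suc j) y1 = z"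
      "y2 \<in> Ch (Suc j) B'" "bd (Suc j) y2 = z"
    using a z0 unfolding acyc_def by blast
  have "(\<lambda>q. y1 q - y2 q) \<in> Ch (Suc j) (B \<union> B')"
    using y chains_diff chains_mono[of B "B \<union> B'"] chains_mono[of B' "B \<union> B'"] by blast
  moreover have "bd (Suc j) (\<lambda>q. y1 q - y2 q) = (\<lambda>_. 0)" using y by (simp add: bdry_diff)
  ultimately obtain t where t: "t \<in> Ch (Suc (Suc j)) (B \<union> B')"
      "bd (Suc (Suc j)) t = (\<lambda>q. y1 q - y2 q)"
    using a(3) unfolding acyc_def by blast
  from t(1) obtain t1 t2 where tt: "t1 \<in> Ch (Suc (Suc j)) B" "t2 \<in> Ch (Suc (Suc j)) B'"
      "t = (\<lambda>q. t1 q + t2 q)" using chains_union by blast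
  \<comment> \<open>Moving the two halves of the filling \<open>t\<close> to opposite sides makes
    the bounding chains agree; their common value \<open>h\<close> then lives on the
    intersection.\<close>
  define h where "h = (\<lambda>q. y1 q - bd (Suc (Suc j)) t1 q)"
  have h2: "h = (\<lambda>q. y2 q + bd (Suc (Suc j)) t2 q)"
  proof
    fix q
    have "y1 q - y2 q = bd (Suc (Suc j)) t1 q + bd (Suc (Suc j)) t2 q"
      using t(2) tt(3) bdry_add by metis
    then show "h q = y2 q + bd (Suc (Suc j)) t2 q" unfolding h_def by (simp add: algebra_simps)
  qed
  have "bd (Suc (Suc j)) t1 \<in> Ch (Suc j) B" by (rule bd_Ch[OF tt(1) down(1)])
  then have "h \<in> Ch (Suc j) B" using y chains_diff unfolding h_def by blast
  moreover have "bd (Suc (Suc j)) t2 \<in> Ch (Suc j) B'" by (rule bd_Ch[OF tt(2) down(2)])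
  then have "h \<in> Ch (Suc j) B'" using y chains_add unfolding h2 by blast
  ultimately have "h \<in> Ch (Suc j) (B \<inter> B')" by (rule chains_inter)
  moreover have "bd (Suc j) (bd (Suc (Suc j)) t1) = (\<lambda>_. 0)"
    by (rule bd_bd[OF tt(1)])
  then have "bd (Suc j) h = z" unfolding h_def bdry_diff y by simp
  ultimately show "\<exists>y\<in>Ch (Suc j) (B \<inter> B'). bd (Suc j) y = z" by blast
qed

text \<open>The new facet \<open>A - {v}\<close> meets the complex in the analogous complex on
  \<open>A - {v}\<close>, which enters one level lower.\<close>

lemma acyc_facets_at_insert:
  assumes "acyc (Suc j) (facets_at A W)" "acyc (Suc j) (Pow (A - {v}))" "acyc j (facets_at (A - {v}) W)"
  shows "acyc (Suc j) (facets_at A (insert v W))"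
  unfolding facets_at_insert
proof (rule mayer_vietoris)
  show "X \<in> facets_at A W \<Longrightarrow> Y \<subset> X \<Longrightarrow> Y \<in> facets_at A W" for X Y
    by (rule facets_at_downward)
  show "X \<in> Pow (A - {v}) \<Longrightarrow> Y \<subset> X \<Longrightarrow> Y \<in> Pow (A - {v})" for X Y by blast
qed (use assms in \<open>simp_all add: facets_at_inter\<close>)

lemma acyc_facets_at_converse:
  assumes "acyc j (facets_at A W)" "acyc j (Pow (A - {v}))" "acyc (Suc j) (facets_at A (insert v W))"
  shows "acyc j (facets_at (A - {v}) W)"
  unfolding facets_at_inter[symmetric]
proof (rule mayer_vietoris_converse)
  show "X \<in> facets_at A W \<Longrightarrow> Y \<subset> X \<Longrightarrow> Y \<in> facets_at A W" for X Y
    by (rule facets_at_downward)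
  show "X \<in> Pow (A - {v}) \<Longrightarrow> Y \<subset> X \<Longrightarrow> Y \<in> Pow (A - {v})" for X Y by blast
qed (use assms in \<open>simp_all add: facets_at_insert\<close>)

lemma acyc_Pow: "A \<subseteq> V \<Longrightarrow> 1 \<le> j \<or> has_nonedge H A \<Longrightarrow> acyc j (Pow A)"
  unfolding acyc_def using exact by blast

text \<open>The only shift at level 0 is the empty set, so every chain there lies in every face, and
  one face whose monomial is in \<open>I(G)\<close> suffices to bound it.\<close>

lemma acyc_0:
  assumes "A \<subseteq> V" "has_nonedge H A" "Pow A \<subseteq> B"
  shows "acyc 0 B"
  unfolding acyc_def
proof (intro ballI impI)
  fix x assume "x \<in> Ch 0 B" "bd 0 x = (\<lambda>_. 0)"
  then have "x \<in> Ch 0 (Pow A)" unfolding chains_def using s0 by auto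
  then obtain y where "y \<in> Ch (Suc 0) (Pow A)" "bd (Suc 0) y = x"
    using exact[OF assms(1) _ bd_0] assms(2) by blast
  then show "\<exists>y\<in>Ch (Suc 0) B. bd (Suc 0) y = x"
    using subsetD[OF chains_mono[OF assms(3)]] by blast
qed

text \<open>Otherwise the basis vector would be a cycle, hence the boundary of a chain below its own
  shift; by \<open>strict\<close> such a boundary has no component at that shift.\<close>

lemma ex_smaller:
  assumes "q < r (Suc j)"
  shows "\<exists>p<r j. s j p \<subset> s (Suc j) q"
proof (rule ccontr)
  assume neg: "\<not> ?thesis"
  define e where "e = (\<lambda>q'. if q' = q then 1 else 0 :: 'k)"
  have e: "e \<in> Ch (Suc j) (Pow (s (Suc j) q))" using assms unfolding e_def chains_def by auto
  have "bd (Suc j) e p = 0" for p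
    using bd_nonzero[of j e p] neg unfolding e_def by (metis (full_types))
  then have "bd (Suc j) e = (\<lambda>_. 0)" by blast
  then obtain y where y: "y \<in> Ch (Suc (Suc j)) (Pow (s (Suc j) q))" "bd (Suc (Suc j)) y = e"
    using exact[OF sV[OF assms] e] by auto
  then have "bd (Suc (Suc j)) y q \<noteq> 0" unfolding e_def by simp
  then show False using bd_nonzero[of "Suc j" y q] y unfolding chains_def by auto
qed

lemma shift_has_nonedge: "q < r (Suc j) \<Longrightarrow> has_nonedge H (s (Suc j) q)"
proof (induction j arbitrary: q)
  case 0
  then show ?case using s1 by simp
next
  case (Suc j)
  then show ?case using ex_smaller has_nonedge_mono by (metis psubset_imp_subset)
qed

text \<open>A shift at level 1 contains an edge of \<open>G\<close>, and by
  \<open>ex_smaller\<close> each further level adds at least one vertex.\<close>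

lemma card_shift: "q < r (Suc j) \<Longrightarrow> j + 2 \<le> card (s (Suc j) q)"
proof (induction j arbitrary: q)
  case 0
  have "has_nonedge H (s 1 q)" using s1 0 by simp
  then obtain u v where "u \<in> s 1 q" "v \<in> s 1 q" "u \<noteq> v"
    unfolding has_nonedge_def by blast
  then have "card {u,v} \<le> card (s 1 q)"
    using sV[of q 1] 0 finite_subset[OF _ finV] by (intro card_mono) auto
  then show ?case using \<open>u \<noteq> v\<close> by simp
next
  case (Suc j)
  then obtain p where "p < r (Suc j)" "s (Suc j) p \<subset> s (Suc (Suc j)) q" using ex_smaller by blast
  moreover from this have "card (s (Suc j) p) < card (s (Suc (Suc j)) q)"
    by (intro psubset_card_mono finite_subset[OF sV[OF Suc.prems] finV])
  ultimately show ?case using Suc.IH[of p] by simp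
qed

text \<open>Shifts at positive levels contain an edge of \<open>G\<close>, so a clique of
  \<open>H\<close> carries no chains there.\<close>

lemma acyc_Un_clique:
  assumes "acyc (Suc j) B" "\<not> has_nonedge H X"
  shows "acyc (Suc j) (B \<union> Pow X)"
proof -
  have "\<not> s (Suc j) q \<subseteq> X" if "q < r (Suc j)" for j q
    using shift_has_nonedge[OF that] has_nonedge_mono assms(2) by metis
  then have "q < r (Suc j) \<and> s (Suc j) q \<in> B \<union> Pow X \<longleftrightarrow> q < r (Suc j) \<and> s (Suc j) q \<in> B" for j q
    by blast
  then have "Ch (Suc j) (B \<union> Pow X) = Ch (Suc j) B" for j
    unfolding chains_def by presburger
  then show ?thesis using assms(1) unfolding acyc_def by simp
qed

text \<open>If \<open>w\<close> is a leaf attached to \<open>u\<close>, the only vertex sets containing \<open>w\<close> without an edge of \<open>G\<close>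
  are \<open>{w}\<close> and \<open>{w, u}\<close>, which cancel each other, so the homology vanishes in all degrees. If \<open>w\<close> is
  isolated, \<open>{w}\<close> survives and contributes in the single degree \<open>card A - 2\<close>.\<close>

lemma acyc_star:
  assumes "A \<subseteq> V" "w \<in> A" "u \<in> A" "w \<noteq> u" "3 \<le> card A" "\<forall>v\<in>A. H w v \<longrightarrow> v = u"
    "W \<subseteq> A - {w}" "u \<in> W" "j + 2 < card A \<or> H w u"
  shows "acyc j (facets_at A W)"
  using assms
\<comment> \<open>Facets are added one at a time, beginning with \<open>W = {u}\<close>, where the
  complex is a full simplex.\<close>
proof (induction "card W" arbitrary: W A j)
  case 0
  then have "finite W" using finite_subset[OF _ finV] by blast
  then show ?case using 0 by auto
next
  case (Suc m)
  have fA: "finite A" using Suc.prems finite_subset[OF _ finV] by blast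
  then have fW: "finite W" using Suc.prems finite_subset by blast
  have neu: "has_nonedge H (A - {u})"
  proof -
    have "\<not> A \<subseteq> {u,w}"
      using card_mono[of "{u,w}" A] Suc.prems by auto
    then obtain t where "t \<in> A" "t \<noteq> w" "t \<noteq> u" by auto
    then show ?thesis using Suc.prems has_nonedgeI[of w "A - {u}" t] by auto
  qed
  have sub: "A - {v} \<subseteq> V" for v using Suc.prems by blast
  show ?case
  proof (cases j)
    case 0
    show ?thesis unfolding 0
      by (rule acyc_0[OF sub neu]) (use Suc.prems in \<open>auto simp: facets_at_def\<close>)
  next
    case j: (Suc j')
    show ?thesis
    proof (cases "W = {u}")
      case True
      have "facets_at A W = Pow (A - {u})" unfolding True facets_at_def by auto
      then show ?thesis using acyc_Pow[OF sub] neu by simp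
    next
      case False
      then obtain v where v: "v \<in> W" "v \<noteq> u" using Suc.prems by blast
      define W' where "W' = W - {v}"
      have W': "W = insert v W'" "m = card W'" "W' \<subseteq> A - {v} - {w}" "W' \<subseteq> A - {w}" "u \<in> W'"
        using v Suc.hyps(2) fW Suc.prems unfolding W'_def by auto
      have vA: "v \<in> A" "v \<noteq> w" using v Suc.prems by auto
      have cAv: "card (A - {v}) = card A - 1"
        using vA Suc.prems fA by auto
      have B1: "acyc j (facets_at A W')"
        by (rule Suc.hyps(1)[OF W'(2)]) (use Suc.prems W' in blast)+
      show ?thesis
      proof (cases "card A = 3")
        case True
        \<comment> \<open>For positive \<open>j\<close> and three vertices,
          \<open>j + 2 < card A\<close> fails. Hence \<open>w\<close> is a leaf at \<open>u\<close>,
          and the added facet is the clique \<open>{w, u}\<close>.\<close>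
        have Hwu: "H w u" using Suc.prems(9) True j by linarith
        have "card (A - {v}) = card {w,u}" using cAv True Suc.prems by auto
        moreover have "{w,u} \<subseteq> A - {v}" using Suc.prems(2,3) v vA by blast
        ultimately have "{w,u} = A - {v}" using card_subset_eq[of "A - {v}" "{w,u}"] fA by simp
        then have "\<not> has_nonedge H (A - {v})"
          using Hwu sym[OF Hwu] unfolding has_nonedge_def by (metis insert_iff singletonD)
        then show ?thesis
          using acyc_Un_clique[of j' "facets_at A W'" "A - {v}"] B1
          unfolding j W'(1) facets_at_insert by blast
      next
        case False
        then have c4: "4 \<le> card A" using Suc.prems by simp
        have B2: "acyc (Suc j') (Pow (A - {v}))" using acyc_Pow[OF sub] by simp
        have "acyc j' (facets_at (A - {v}) W')"
        proof (rule Suc.hyps(1)[OF W'(2)])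
          show "j' + 2 < card (A - {v}) \<or> H w u" using Suc.prems(9) cAv j by linarith
          show "3 \<le> card (A - {v})" using c4 cAv by linarith
        qed (use Suc.prems W' vA v in blast)+
        then show ?thesis
          using acyc_facets_at_insert[of j' A W' v] B1 B2 unfolding j W'(1) by blast
      qed
    qed
  qed
qed

text \<open>The boundary of the simplex consists of the complex treated in \<open>acyc_star\<close>
  and the opposite facet \<open>A - {w}\<close>; these meet in the boundary of
  \<open>A - {w}\<close>. If \<open>A\<close> is connected, \<open>w\<close> is a leaf and
  \<open>A - {w}\<close> stays connected, so the induction goes on.\<close>

lemma acyc_boundary:
  assumes "A \<subseteq> V" "3 \<le> card A" "j + 2 < card A \<or> \<not> disc A"
  shows "acyc j (facets_at A A)"
  using assms
proof (induction "card A" arbitrary: A j rule: less_induct)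
  case less
  have fA: "finite A" using less.prems finite_subset[OF _ finV] by blast
  obtain w u where wu: "w \<in> A" "u \<in> A" "w \<noteq> u" "\<forall>v\<in>A. H w v \<longrightarrow> v = u" "disc A \<or> H w u"
    using deg1_pair[of A] less.prems by auto
  have B1: "acyc j (facets_at A (A - {w}))"
    by (rule acyc_star[of A w u]) (use wu less.prems in auto)
  have cw: "card (A - {w}) = card A - 1" using fA wu by simp
  have eq: "facets_at A A = facets_at A (A - {w}) \<union> Pow (A - {w})"
    using facets_at_insert[of A w "A - {w}"] wu by (simp add: insert_absorb)
  show ?case
  proof (cases j)
    case 0
    have "card {u,w} = 2" using wu by simp
    then have "\<not> A \<subseteq> {u,w}" using card_mono[of "{u,w}" A] less.prems(2) by auto
    then obtain t where "t \<in> A" "t \<noteq> w" "t \<noteq> u" by auto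
    then have "has_nonedge H (A - {u})" using wu has_nonedgeI[of w "A - {u}" t] by auto
    then show ?thesis unfolding 0
      using acyc_0[of "A - {u}" "facets_at A A"] wu less.prems by (auto simp: facets_at_def)
  next
    case (Suc j')
    have nd: "\<not> disc (A - {w})" if "\<not> disc A" using leaf_disc[of w A u] wu that by blast
    show ?thesis
    proof (cases "card A = 3")
      case True
      \<comment> \<open>Again \<open>j + 2 < 3\<close> fails, so \<open>A\<close> is connected, and
        the two remaining vertices form an edge of \<open>H\<close>.\<close>
      then have "\<not> disc A" using less.prems Suc by simp
      then have "\<not> has_nonedge H (A - {w})"
      proof -
        have "card (A - {w}) = 2" using cw True by simp
        moreover from this obtain a b where "A - {w} = {a,b}" "a \<noteq> b" by (auto simp: card_2_iff)
        ultimately show ?thesis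
          using isolated_disc[of a "A - {w}"] nd[OF \<open>\<not> disc A\<close>] irrefl sym
          unfolding has_nonedge_def by auto
      qed
      then show ?thesis
        using acyc_Un_clique[of j' "facets_at A (A - {w})"] B1 Suc eq by simp
    next
      case False
      have "acyc j' (facets_at (A - {w}) (A - {w}))"
        by (rule less.hyps) (use less.prems cw False Suc nd in auto)
      moreover have "acyc (Suc j') (Pow (A - {w}))"
        by (rule acyc_Pow) (use less.prems in auto)
      ultimately have "acyc j (facets_at A (insert w (A - {w})))"
        using B1 acyc_facets_at_insert unfolding Suc by blast
      then show ?thesis using wu by (simp add: insert_absorb)
    qed
  qed
qed

text \<open>Acyclicity would descend by the converse Mayer-Vietoris step to \<open>A - {w}\<close>,
  still disconnected, and finally to two nonadjacent vertices. Their proper subsets contain no edge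
  of \<open>G\<close>, so nothing bounds the generator at level 0.\<close>

lemma not_acyc_boundary:
  assumes "A \<subseteq> V" "disc A" "card A = m + 2"
  shows "\<not> acyc m (facets_at A A)"
  using assms
proof (induction m arbitrary: A)
  case 0
  then have "card A = 2" by simp
  then obtain a b where ab: "A = {a,b}" "a \<noteq> b" by (auto simp: card_2_iff)
  define e where "e = (\<lambda>q::nat. if q = 0 then 1 else 0 :: 'k)"
  have e: "e \<in> Ch 0 (facets_at A A)" using r0 s0 ab unfolding e_def chains_def facets_at_def by auto
  show ?case
  proof
    assume "acyc 0 (facets_at A A)"
    then obtain y where y: "y \<in> Ch (Suc 0) (facets_at A A)" "bd (Suc 0) y = e"
      using e bd_0 unfolding acyc_def by blast
    have "bd (Suc 0) y 0 \<noteq> 0" using y unfolding e_def by simp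
    then obtain q where "q < r (Suc 0)" "y q \<noteq> 0" using bd_nonzero by blast
    then have "has_nonedge H (s (Suc 0) q)" "s (Suc 0) q \<in> facets_at A A"
      using shift_has_nonedge y unfolding chains_def by auto
    then show False using ab unfolding has_nonedge_def facets_at_def by auto
  qed
next
  case (Suc m)
  have fA: "finite A" using Suc.prems finite_subset[OF _ finV] by blast
  obtain w u where wu: "w \<in> A" "u \<in> A" "w \<noteq> u" "\<forall>v\<in>A. H w v \<longrightarrow> v = u" "disc (A - {w})"
    using disc_deg1_pair[of A] Suc.prems by auto
  have eq: "A = insert w (A - {w})" using wu by blast
  have 1: "\<not> acyc m (facets_at (A - {w}) (A - {w}))"
    by (rule Suc.IH) (use Suc.prems wu fA in auto)
  have 2: "acyc m (facets_at A (A - {w}))"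
    by (rule acyc_star[of A w u]) (use wu Suc.prems in auto)
  have 3: "acyc m (Pow (A - {w}))"
    by (rule acyc_Pow) (use Suc.prems wu disconnected_on_has_nonedge in auto)
  show ?case
    using 1 acyc_facets_at_converse[OF 2 3] eq by fastforce
qed

text \<open>The boundary of the basis element \<open>e\<close> lives on proper subsets of its shift.
  If some \<open>y\<close> bounded it there, \<open>e - y\<close> would be a cycle and hence a
  boundary with a component at the shift itself, against \<open>strict\<close>.\<close>

lemma no_shift_if_acyc:
  assumes q: "q < r (Suc j)" and a: "acyc j (facets_at (s (Suc j) q) (s (Suc j) q))"
  shows False
proof -
  let ?A = "s (Suc j) q"
  define e where "e = (\<lambda>q'. if q' = q then 1 else 0 :: 'k)"
  have e: "e \<in> Ch (Suc j) {?A}" using q unfolding e_def chains_def by auto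
  have "bd (Suc j) e \<in> Ch j (facets_at ?A ?A)"
    by (rule bd_Ch[OF e]) (auto simp: facets_at_def)
  moreover have "bd j (bd (Suc j) e) = (\<lambda>_. 0)" by (rule bd_bd[OF e])
  ultimately obtain y where y: "y \<in> Ch (Suc j) (facets_at ?A ?A)" "bd (Suc j) y = bd (Suc j) e"
    using a unfolding acyc_def by blast
  have "e \<in> Ch (Suc j) (Pow ?A)" using e chains_mono[of "{?A}" "Pow ?A"] by blast
  moreover have "y \<in> Ch (Suc j) (Pow ?A)"
    using y chains_mono[OF facets_at_subset_Pow] by blast
  ultimately have "(\<lambda>x. e x - y x) \<in> Ch (Suc j) (Pow ?A)" by (rule chains_diff)
  moreover have "bd (Suc j) (\<lambda>x. e x - y x) = (\<lambda>_. 0)" using y by (simp add: bdry_diff)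
  ultimately obtain t where t: "t \<in> Ch (Suc (Suc j)) (Pow ?A)" "bd (Suc (Suc j)) t = (\<lambda>x. e x - y x)"
    using exact[OF sV[OF q]] by auto
  have "y q = 0" using y unfolding chains_def facets_at_def by blast
  then have "bd (Suc (Suc j)) t q \<noteq> 0" using t unfolding e_def by simp
  then show False using bd_nonzero[of "Suc j" t q] t unfolding chains_def by auto
qed

text \<open>Both directions compare the full simplex on \<open>A\<close>, which is exact, with its
  boundary: the two have the same chains at level \<open>Suc j\<close> unless \<open>A\<close> is
  itself a shift there.\<close>

theorem shift_iff:
  "(\<exists>q<r (Suc j). s (Suc j) q = A) \<longleftrightarrow> A \<subseteq> V \<and> card A = j + 2 \<and> disc A"
proof
  assume "\<exists>q<r (Suc j). s (Suc j) q = A"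
  then obtain q where q: "q < r (Suc j)" "s (Suc j) q = A" by blast
  have AV: "A \<subseteq> V" and c: "j + 2 \<le> card A" and ne: "has_nonedge H A"
    using q sV card_shift shift_has_nonedge by blast+
  have no: "\<not> acyc j (facets_at A A)" using no_shift_if_acyc q by blast
  have 1: "card A = j + 2"
  proof (rule ccontr)
    assume "card A \<noteq> j + 2"
    then have "j + 2 < card A" using c by simp
    then show False using acyc_boundary[OF AV, of j] no by simp
  qed
  have "disc A"
  proof (rule ccontr)
    assume nd: "\<not> disc A"
    then have "\<not> 3 \<le> card A" using acyc_boundary[OF AV] no by blast
    then have "card A = 2" using 1 by simp
    then obtain a b where "A = {a,b}" "a \<noteq> b" by (auto simp: card_2_iff)
    then show False using ne isolated_disc[of a A] nd \<open>card A = 2\<close> irrefl sym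
      unfolding has_nonedge_def by auto
  qed
  then show "A \<subseteq> V \<and> card A = j + 2 \<and> disc A" using AV 1 by blast
next
  assume A: "A \<subseteq> V \<and> card A = j + 2 \<and> disc A"
  show "\<exists>q<r (Suc j). s (Suc j) q = A"
  proof (rule ccontr)
    assume neg: "\<not> ?thesis"
    have "acyc j (facets_at A A)"
      unfolding acyc_def
    proof (intro ballI impI)
      fix x assume x: "x \<in> Ch j (facets_at A A)" "bd j x = (\<lambda>_. 0)"
      have "x \<in> Ch j (Pow A)" using x chains_mono[OF facets_at_subset_Pow] by blast
      then obtain y where y: "y \<in> Ch (Suc j) (Pow A)" "bd (Suc j) y = x"
        using exact[of A x j] x A disconnected_on_has_nonedge by blast
      have "y \<in> Ch (Suc j) (facets_at A A)"
      proof -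
        have "q < r (Suc j) \<and> s (Suc j) q \<in> facets_at A A" if "y q \<noteq> 0" for q
        proof -
          have "q < r (Suc j)" "s (Suc j) q \<subseteq> A" using y(1) that unfolding chains_def by auto
          moreover from this have "s (Suc j) q \<noteq> A" using neg by blast
          ultimately show ?thesis unfolding facets_at_def by blast
        qed
        then show ?thesis unfolding chains_def by blast
      qed
      then show "\<exists>y\<in>Ch (Suc j) (facets_at A A). bd (Suc j) y = x" using y by blast
    qed
    then show False using not_acyc_boundary A by blast
  qed
qed

end

section \<open>Linear quotients of set families\<close>

lemma forest_deg1:
  assumes f: "forest n H" and sym: "\<And>u v. H u v \<Longrightarrow> H v u" and irrefl: "\<And>u. \<not> H u u"
    and A: "A \<subseteq> {..<n}" "A \<noteq> {}"
  shows "\<exists>w\<in>A. \<exists>u. \<forall>v\<in>A. H w v \<longrightarrow> v = u"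
proof (rule ccontr)
  \<comment> \<open>Otherwise the first vertex of a longest path has a second neighbour on it, which closes a cycle.\<close>
  assume "\<not> ?thesis"
  then have two: "\<exists>v\<in>A. H w v \<and> v \<noteq> u" if "w \<in> A" for w u using that by blast
  define P where "P p \<longleftrightarrow> p \<noteq> [] \<and> distinct p \<and> set p \<subseteq> A \<and>
    (\<forall>i. Suc i < length p \<longrightarrow> H (p ! i) (p ! Suc i))" for p
  obtain a where "a \<in> A" using A by blast
  then have "P [a]" unfolding P_def by simp
  moreover have "length p < Suc (card A)" if "P p" for p
    using that card_mono[of A "set p"] distinct_card[of p] A finite_subset[of A "{..<n}"]
    unfolding P_def by auto
  ultimately obtain p where p: "P p" "\<And>q. P q \<Longrightarrow> length q \<le> length p"
    using ex_has_greatest_nat[of P "[a]" length "Suc (card A)"] by (metis less_imp_le)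
  obtain w p' where wp: "p = w # p'" using p unfolding P_def by (meson neq_Nil_conv)
  have w: "w \<in> A" using p wp unfolding P_def by auto
  obtain v where v: "v \<in> A" "H w v" "v \<noteq> p ! 1" using two[OF w] by blast
  have "v \<in> set p"
  proof (rule ccontr)
    assume vn: "v \<notin> set p"
    have "H ((v # p) ! i) ((v # p) ! Suc i)" if "Suc i < length (v # p)" for i
      using that v p(1) sym wp unfolding P_def by (cases i) auto
    then have "P (v # p)" using p(1) v vn unfolding P_def by auto
    then show False using p(2) by fastforce
  qed
  then obtain i where i: "i < length p" "p ! i = v" by (meson in_set_conv_nth)
  have "i \<noteq> 0" using i v irrefl wp by (metis nth_Cons_0)
  moreover have "i \<noteq> 1" using i v by blast
  ultimately have i2: "2 \<le> i" by simp
  let ?c = "take (Suc i) p"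
  have "is_cycle n H ?c"
    unfolding is_cycle_def
  proof (intro conjI allI impI)
    show "3 \<le> length ?c" using i i2 by simp
    show "distinct ?c" using p unfolding P_def by simp
    show "set ?c \<subseteq> {..<n}" using p A set_take_subset[of "Suc i" p] unfolding P_def by blast
    show "H (?c ! k) (?c ! Suc k)" if "Suc k < length ?c" for k
      using that p unfolding P_def by simp
    have "last ?c = v" using i by (simp add: take_Suc_conv_app_nth)
    moreover have "hd ?c = w" using wp by simp
    ultimately show "H (last ?c) (hd ?c)" using v sym by simp
  qed
  then show False using f unfolding forest_def by blast
qed

text \<open>The exchange form of linear quotients for squarefree monomials:
  \<open>C - us ! i = {v}\<close> means that \<open>C\<close> contributes the variable
  \<open>v\<close> to the colon ideal, and this variable divides the contribution of
  \<open>B\<close>.\<close>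

definition lq_list :: "'v set list \<Rightarrow> bool" where
  "lq_list us \<longleftrightarrow> (\<forall>i<length us. \<forall>B\<in>set (take i us). \<exists>C\<in>set (take i us). \<exists>v\<in>B. C - us ! i = {v})"

definition lq_family :: "'v set set \<Rightarrow> bool" where
  "lq_family T \<longleftrightarrow> (\<exists>us. distinct us \<and> set us = T \<and> lq_list us)"

lemma lq_list_Nil: "lq_list []"
  unfolding lq_list_def by simp

lemma lq_list_snoc:
  "lq_list (us @ [A]) \<longleftrightarrow> lq_list us \<and> (\<forall>B\<in>set us. \<exists>C\<in>set us. \<exists>v\<in>B. C - A = {v})"
  unfolding lq_list_def by (auto simp: nth_append less_Suc_eq all_conj_distrib imp_conjR)

text \<open>All exchanges land in \<open>T\<close>, which precedes the whole of \<open>T'\<close>,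
  so the members of \<open>T'\<close> may be appended in any order.\<close>

lemma lq_family_extend:
  assumes "lq_family T" "finite T'"
    and "\<And>A B. A \<in> T' \<Longrightarrow> B \<in> T \<union> T' \<Longrightarrow> B \<noteq> A \<Longrightarrow> \<exists>C\<in>T. \<exists>v\<in>B. C - A = {v}"
    and "T \<inter> T' = {}"
  shows "lq_family (T \<union> T')"
  using assms(2,3,4)
proof (induction T' rule: finite_induct)
  case empty
  then show ?case using assms(1) by simp
next
  case (insert A T')
  have "lq_family (T \<union> T')"
    by (rule insert.IH) (use insert.prems in auto)
  then obtain us where us: "distinct us" "set us = T \<union> T'" "lq_list us" unfolding lq_family_def by blast
  have "A \<notin> set us" using us insert by auto
  moreover have "\<exists>C\<in>set us. \<exists>v\<in>B. C - A = {v}" if "B \<in> set us" for B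
  proof -
    have "B \<noteq> A" using that \<open>A \<notin> set us\<close> by blast
    then show ?thesis using insert.prems(1)[of A B] that us(2) by blast
  qed
  ultimately have "distinct (us @ [A]) \<and> set (us @ [A]) = T \<union> insert A T' \<and> lq_list (us @ [A])"
    using us by (auto simp: lq_list_snoc)
  then show ?case unfolding lq_family_def by blast
qed

text \<open>Here \<open>T'\<close> keeps an order of its own, which handles pairs inside
  \<open>T'\<close>; only pairs across the two families call for an exchange into
  \<open>T\<close>.\<close>

lemma lq_family_Un:
  assumes "lq_family T" "lq_family T'" "T \<inter> T' = {}"
    and x: "\<And>A B. A \<in> T' \<Longrightarrow> B \<in> T \<Longrightarrow> \<exists>C\<in>T. \<exists>v\<in>B. C - A = {v}"
  shows "lq_family (T \<union> T')"
proof -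
  obtain us vs where us: "distinct us" "set us = T" "lq_list us"
    and vs: "distinct vs" "set vs = T'" "lq_list vs"
    using assms unfolding lq_family_def by metis
  have "lq_list (us @ ws)" if "lq_list ws" "set ws \<subseteq> T'" for ws
    using that
  proof (induction ws rule: rev_induct)
    case Nil
    then show ?case using us by simp
  next
    case (snoc A ws)
    have ws: "lq_list ws" and A: "A \<in> T'" using snoc.prems by (auto simp: lq_list_snoc)
    have "lq_list (us @ ws)" using snoc ws by simp
    moreover have "\<exists>C\<in>set (us @ ws). \<exists>v\<in>B. C - A = {v}" if "B \<in> set (us @ ws)" for B
    proof (cases "B \<in> T")
      case True
      then obtain C v where "C \<in> T" "v \<in> B" "C - A = {v}" using x[OF A] by blast
      moreover from this have "C \<in> set (us @ ws)" using us(2) by simp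
      ultimately show ?thesis by blast
    next
      case False
      then have "B \<in> set ws" using that us by simp
      then obtain C v where "C \<in> set ws" "v \<in> B" "C - A = {v}"
        using snoc.prems(1) unfolding lq_list_snoc by blast
      moreover from this have "C \<in> set (us @ ws)" by simp
      ultimately show ?thesis by blast
    qed
    ultimately have "lq_list ((us @ ws) @ [A])" unfolding lq_list_snoc by blast
    then show ?case by simp
  qed
  then have "distinct (us @ vs) \<and> set (us @ vs) = T \<union> T' \<and> lq_list (us @ vs)"
    using us vs assms(3) by auto
  then show ?thesis unfolding lq_family_def by blast
qed

text \<open>A common new element cancels in all differences.\<close>

lemma lq_family_insert_image:
  assumes "lq_family T" "\<And>A. A \<in> T \<Longrightarrow> x \<notin> A"
  shows "lq_family (insert x ` T)"
proof -
  obtain us where us: "distinct us" "set us = T" "lq_list us"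
    using assms unfolding lq_family_def by metis
  have "lq_list (map (insert x) ws)" if "lq_list ws" "\<And>A. A \<in> set ws \<Longrightarrow> x \<notin> A" for ws
    using that
  proof (induction ws rule: rev_induct)
    case Nil
    then show ?case by (simp add: lq_list_Nil)
  next
    case (snoc A ws)
    have "lq_list (map (insert x) ws)" using snoc by (simp add: lq_list_snoc)
    moreover have "\<exists>C\<in>set (map (insert x) ws). \<exists>v\<in>B. C - insert x A = {v}"
      if B: "B \<in> set (map (insert x) ws)" for B
    proof -
      obtain B' where B': "B' \<in> set ws" "B = insert x B'" using B by auto
      then obtain C v where C: "C \<in> set ws" "v \<in> B'" "C - A = {v}"
        using snoc.prems(1) unfolding lq_list_snoc by blast
      have "x \<notin> C" using C snoc.prems(2) by simp
      then have "insert x C - insert x A = {v}" using C by blast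
      then show ?thesis using C B' by (intro bexI[of _ "insert x C"] bexI[of _ v]) auto
    qed
    ultimately show ?case by (simp add: lq_list_snoc)
  qed
  then have "lq_list (map (insert x) us)" using us assms by blast
  moreover have "inj_on (insert x) T" using assms(2) by (intro inj_onI) (metis insert_ident)
  then have "distinct (map (insert x) us)" using us by (simp add: distinct_map)
  ultimately show ?thesis unfolding lq_family_def using us
    by (intro exI[of _ "map (insert x) us"]) simp
qed

text \<open>Sets containing \<open>x\<close> come first; a set avoiding \<open>x\<close> trades one
  of its elements for \<open>x\<close>.\<close>

lemma lq_family_uniform: "finite X \<Longrightarrow> lq_family {B. B \<subseteq> X \<and> card B = m}"
proof (induction X arbitrary: m rule: finite_induct)
  case empty
  show ?case
  proof (cases m)
    case 0
    have "{B. B \<subseteq> {} \<and> card B = m} = {{}}" using 0 by auto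
    then show ?thesis unfolding lq_family_def
      by (intro exI[of _ "[{}]"]) (auto simp: lq_list_def)
  next
    case (Suc m')
    then have "{B. B \<subseteq> {} \<and> card B = m} = {}" by auto
    then show ?thesis unfolding lq_family_def
      by (intro exI[of _ "[]"]) (auto simp: lq_list_def)
  qed
next
  case (insert x X)
  show ?case
  proof (cases m)
    case 0
    have iff: "B \<subseteq> insert x X \<and> card B = m \<longleftrightarrow> B = {}" for B
      using finite_subset[of B "insert x X"] insert.hyps(1) unfolding 0
      by (metis card_0_eq empty_subsetI finite.insertI)
    have "{B. B \<subseteq> insert x X \<and> card B = m} = {{}}"
      unfolding iff by simp
    then show ?thesis unfolding lq_family_def
      by (intro exI[of _ "[{}]"]) (auto simp: lq_list_def)
  next
    case (Suc m')
    let ?T = "insert x ` {B. B \<subseteq> X \<and> card B = m'}" and ?T' = "{B. B \<subseteq> X \<and> card B = m}"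
    have fin: "finite B" if "B \<subseteq> X" for B using that insert.hyps finite_subset by blast
    have "{B. B \<subseteq> insert x X \<and> card B = m} = ?T \<union> ?T'"
    proof (intro equalityI subsetI)
      fix B assume B: "B \<in> {B. B \<subseteq> insert x X \<and> card B = m}"
      show "B \<in> ?T \<union> ?T'"
      proof (cases "x \<in> B")
        case True
        then have "B = insert x (B - {x})" "B - {x} \<subseteq> X" "card (B - {x}) = m'"
          using B Suc fin[of "B - {x}"] by auto
        then show ?thesis by blast
      qed (use B in auto)
    next
      fix B assume "B \<in> ?T \<union> ?T'"
      then show "B \<in> {B. B \<subseteq> insert x X \<and> card B = m}"
        using Suc fin insert.hyps by (auto simp: subset_iff card_insert_if)
    qed
    moreover have "lq_family (?T \<union> ?T')"
    proof (rule lq_family_Un)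
      show "lq_family ?T"
        by (rule lq_family_insert_image) (use insert in auto)
      show "lq_family ?T'" by (rule insert.IH)
      show "?T \<inter> ?T' = {}" using insert.hyps by auto
      fix A B assume A: "A \<in> ?T'" and B: "B \<in> ?T"
      then obtain a where a: "a \<in> A" using Suc by (metis (mono_tags) card.empty equals0I mem_Collect_eq nat.distinct(1))
      have "A - {a} \<subseteq> X" "card (A - {a}) = m'" using A a Suc fin[of A] by auto
      then have "insert x (A - {a}) \<in> ?T" by blast
      moreover have "insert x (A - {a}) - A = {x}" using A insert.hyps by auto
      moreover have "x \<in> B" using B by auto
      ultimately show "\<exists>C\<in>?T. \<exists>v\<in>B. C - A = {v}" by blast
    qed
    ultimately show ?thesis by simp
  qed
qed

section \<open>Linear quotients for the disconnected sets\<close>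

context deg1_graph
begin

lemma lq_family_disc:
  assumes "W \<subseteq> V" "2 \<le> m"
  shows "lq_family {A. A \<subseteq> W \<and> card A = m \<and> disc A}"
  using assms
proof (induction "card W" arbitrary: W rule: less_induct)
  case less
  have fW: "finite W" using less.prems finV finite_subset by blast
  have fin: "finite A" if "A \<subseteq> W" for A using that fW finite_subset by blast
  show ?case
  proof (cases "W = {}")
    case True
    then have "{A. A \<subseteq> W \<and> card A = m \<and> disc A} = {}" using less.prems by auto
    then show ?thesis unfolding lq_family_def using lq_list_Nil by (intro exI[of _ "[]"]) simp
  next
    case False
    then obtain w u' where w: "w \<in> W" "\<forall>v\<in>W. H w v \<longrightarrow> v = u'" using deg1 less.prems by meson
    \<comment> \<open>For isolated \<open>w\<close>, any vertex other than \<open>w\<close> can play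
      the part of \<open>u\<close>, even one outside \<open>W\<close>; \<open>Suc w\<close> is such
      a choice.\<close>
    obtain u where u: "u \<noteq> w" "\<forall>v\<in>W. H w v \<longrightarrow> v = u"
    proof (cases "u' = w")
      case True
      then have "\<forall>v\<in>W. \<not> H w v" using w irrefl by blast
      then show ?thesis using that[of "Suc w"] by simp
    qed (use w that in blast)
    define T1 where "T1 = {A. A \<subseteq> W \<and> card A = m \<and> w \<in> A \<and> u \<notin> A}"
    define T2 where "T2 = {A. A \<subseteq> W \<and> card A = m \<and> w \<in> A \<and> u \<in> A \<and> disc A}"
    define T3 where "T3 = {A. A \<subseteq> W - {w} \<and> card A = m \<and> disc A}"
    have "disc A" if "A \<in> T1" for A
      using isolated_disc[of w A] that u less.prems unfolding T1_def by auto
    then have eq: "{A. A \<subseteq> W \<and> card A = m \<and> disc A} = (T1 \<union> T2) \<union> T3"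
      unfolding T1_def T2_def T3_def by auto
    have "T1 = insert w ` {B. B \<subseteq> W - {w,u} \<and> card B = m - 1}"
    proof (intro equalityI subsetI)
      fix A assume A: "A \<in> T1"
      then have "A = insert w (A - {w})" "A - {w} \<subseteq> W - {w,u}" "card (A - {w}) = m - 1"
        using fin unfolding T1_def by auto
      then show "A \<in> insert w ` {B. B \<subseteq> W - {w,u} \<and> card B = m - 1}" by blast
    next
      fix A assume "A \<in> insert w ` {B. B \<subseteq> W - {w,u} \<and> card B = m - 1}"
      then obtain B where B: "A = insert w B" "B \<subseteq> W - {w,u}" "card B = m - 1" by blast
      moreover have "finite B" "w \<notin> B" using B fin by blast+
      ultimately show "A \<in> T1" using w u less.prems(2) unfolding T1_def by auto
    qed
    moreover have "lq_family (insert w ` {B. B \<subseteq> W - {w,u} \<and> card B = m - 1})"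
      by (rule lq_family_insert_image[OF lq_family_uniform]) (use fW in auto)
    ultimately have 1: "lq_family T1" by simp
    \<comment> \<open>In a set with \<open>w\<close> and without \<open>u\<close> disconnectedness
      is automatic, so an exchange only has to respect size and these two memberships.\<close>
    have exch: "insert v (A - {a}) \<in> T1" if "A \<subseteq> W" "card A = m" "v \<in> W" "v \<notin> A" "a \<in> A"
      "w \<in> insert v (A - {a})" "u \<notin> insert v (A - {a})" for A a v
      using that fin less.prems(2) unfolding T1_def by auto
    have 2: "lq_family (T1 \<union> T2)"
    proof (rule lq_family_extend[OF 1])
      show "finite T2" unfolding T2_def using fW by (auto intro: finite_subset[of _ "Pow W"])
      show "T1 \<inter> T2 = {}" unfolding T1_def T2_def by auto
      fix A B assume A: "A \<in> T2" and B: "B \<in> T1 \<union> T2" "B \<noteq> A"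
      have "B \<subseteq> W" "card B = m" "A \<subseteq> W" "card A = m" "u \<in> A" "w \<in> A"
        using A B unfolding T1_def T2_def by auto
      \<comment> \<open>Equal sizes ensure that \<open>B\<close> supplies a vertex outside
        \<open>A\<close>, which then replaces \<open>u\<close>.\<close>
      then have "\<not> B \<subseteq> A" using card_subset_eq[of A B] B fin by auto
      then obtain v where v: "v \<in> B" "v \<notin> A" by blast
      have "insert v (A - {u}) \<in> T1"
        by (rule exch) (use v \<open>B \<subseteq> W\<close> \<open>A \<subseteq> W\<close> \<open>card A = m\<close> \<open>u \<in> A\<close> \<open>w \<in> A\<close> u in auto)
      moreover have "insert v (A - {u}) - A = {v}" using v by auto
      ultimately show "\<exists>C\<in>T1. \<exists>v\<in>B. C - A = {v}" using v by blast
    qed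
    have "card (W - {w}) < card W" using w fW by (intro card_Diff1_less)
    then have 3: "lq_family T3" unfolding T3_def
      by (rule less.hyps) (use less.prems in auto)
    have "lq_family ((T1 \<union> T2) \<union> T3)"
    proof (rule lq_family_Un[OF 2 3])
      show "(T1 \<union> T2) \<inter> T3 = {}" unfolding T1_def T2_def T3_def by auto
      fix A B assume A: "A \<in> T3" and B: "B \<in> T1 \<union> T2"
      have A': "A \<subseteq> W" "card A = m" "w \<notin> A" using A unfolding T3_def by auto
      then have "A \<noteq> {}" using less.prems by auto
      \<comment> \<open>If \<open>u\<close> belongs to \<open>A\<close>, it must be the vertex given
        up, since members of \<open>T1\<close> avoid it.\<close>
      then obtain a where a: "a \<in> A" "u \<in> A \<longrightarrow> a = u" by blast
      have "insert w (A - {a}) \<in> T1" by (rule exch) (use A' a u w in auto)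
      moreover have "insert w (A - {a}) - A = {w}" using A' by auto
      moreover have "w \<in> B" using B unfolding T1_def T2_def by auto
      ultimately show "\<exists>C\<in>T1 \<union> T2. \<exists>v\<in>B. C - A = {v}" by blast
    qed
    then show ?thesis unfolding eq .
  qed
qed

end

section \<open>Monomial ideals\<close>

lemma exp_le_refl: "exp_le a a"
  unfolding exp_le_def by simp

lemma exp_le_trans: "exp_le a b \<Longrightarrow> exp_le b c \<Longrightarrow> exp_le a c"
  unfolding exp_le_def using le_trans by blast

lemma exp_le_antisym: "exp_le a b \<Longrightarrow> exp_le b a \<Longrightarrow> a = b"
  unfolding exp_le_def by (intro poly_mapping_eqI) (simp add: le_antisym)

lemma exp_le_add_diff: "exp_le a b \<Longrightarrow> a + (b - a) = b"
  unfolding exp_le_def by (intro poly_mapping_eqI) (simp add: lookup_add lookup_minus)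

lemma exp_le_keys: "exp_le a b \<Longrightarrow> Poly_Mapping.keys a \<subseteq> Poly_Mapping.keys b"
  unfolding exp_le_def in_keys_iff subset_iff by (metis le_zero_eq)

lemma keys_exp_diff: "Poly_Mapping.keys (a - b :: nat \<Rightarrow>\<^sub>0 nat) \<subseteq> Poly_Mapping.keys a"
  by (auto simp: in_keys_iff lookup_minus)

lemma exp_le_add_right: "exp_le a (c + a)" "exp_le a (a + c)"
  unfolding exp_le_def by (auto simp: lookup_add)

lemma keys_exp_add: "Poly_Mapping.keys (a + b :: nat \<Rightarrow>\<^sub>0 nat) = Poly_Mapping.keys a \<union> Poly_Mapping.keys b"
  by (auto simp: in_keys_iff lookup_add)

lemma poly_mapping_sum_singles: "p = (\<Sum>a\<in>Poly_Mapping.keys p. Poly_Mapping.single a (Poly_Mapping.lookup p a))"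
proof (rule poly_mapping_eqI)
  fix k
  have "Poly_Mapping.lookup (\<Sum>a\<in>Poly_Mapping.keys p. Poly_Mapping.single a (Poly_Mapping.lookup p a)) k = (\<Sum>a\<in>Poly_Mapping.keys p. if a = k then Poly_Mapping.lookup p a else 0)"
    unfolding lookup_sum by (intro sum.cong) (auto simp: lookup_single)
  also have "\<dots> = Poly_Mapping.lookup p k" by (auto simp: in_keys_iff)
  finally show "Poly_Mapping.lookup p k = Poly_Mapping.lookup (\<Sum>a\<in>Poly_Mapping.keys p. Poly_Mapping.single a (Poly_Mapping.lookup p a)) k" by simp
qed

lemma lookup_single_times:
  fixes f :: "'k::comm_semiring_1 mpoly"
  shows "Poly_Mapping.lookup (Poly_Mapping.single a c * f) d = (if exp_le a d then c * Poly_Mapping.lookup f (d - a) else 0)"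
proof -
  have eq: "a + k = d \<longleftrightarrow> exp_le a d \<and> k = d - a" for k
    using exp_le_add_diff exp_le_add_right(2)[of a k] by auto
  have "Poly_Mapping.single a c * f = (\<Sum>k\<in>Poly_Mapping.keys f. Poly_Mapping.single (a + k) (c * Poly_Mapping.lookup f k))"
    by (subst poly_mapping_sum_singles[of f]) (simp add: sum_distrib_left mult_single)
  then have "Poly_Mapping.lookup (Poly_Mapping.single a c * f) d =
      (\<Sum>k\<in>Poly_Mapping.keys f. if exp_le a d \<and> k = d - a then c * Poly_Mapping.lookup f k else 0)"
    by (simp add: lookup_sum lookup_single when_def eq)
  also have "\<dots> = (if exp_le a d then c * Poly_Mapping.lookup f (d - a) else 0)"
    by (auto simp: in_keys_iff)
  finally show ?thesis .
qed

lemma keys_times_mono: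
  "Poly_Mapping.keys (f * mono a :: 'k::comm_semiring_1 mpoly) = (\<lambda>c. c + a) ` Poly_Mapping.keys f"
proof -
  have "d \<in> Poly_Mapping.keys (f * mono a) \<longleftrightarrow> d \<in> (\<lambda>c. c + a) ` Poly_Mapping.keys f" for d
  proof -
    have "d \<in> Poly_Mapping.keys (f * mono a) \<longleftrightarrow> exp_le a d \<and> d - a \<in> Poly_Mapping.keys f"
      unfolding mono_def by (simp add: mult.commute[of f] in_keys_iff lookup_single_times)
    also have "\<dots> \<longleftrightarrow> d \<in> (\<lambda>c. c + a) ` Poly_Mapping.keys f"
    proof
      assume "exp_le a d \<and> d - a \<in> Poly_Mapping.keys f"
      then show "d \<in> (\<lambda>c. c + a) ` Poly_Mapping.keys f"
        using exp_le_add_diff[of a d] by (intro image_eqI[of _ _ "d - a"]) (auto simp: add.commute)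
    qed (use exp_le_add_right(1)[of a] in auto)
    finally show ?thesis .
  qed
  then show ?thesis by blast
qed

lemma in_S_0: "in_S n 0"
  unfolding in_S_def by simp

lemma in_S_add: "in_S n p \<Longrightarrow> in_S n q \<Longrightarrow> in_S n (p + q)"
  unfolding in_S_def using keys_add[of p q] by blast

lemma in_S_single: "Poly_Mapping.keys a \<subseteq> {..<n} \<Longrightarrow> in_S n (Poly_Mapping.single a c)"
  unfolding in_S_def by simp

lemma in_S_mult: "in_S n p \<Longrightarrow> in_S n q \<Longrightarrow> in_S n (p * q)"
  unfolding in_S_def
proof
  fix a assume p: "\<forall>a\<in>Poly_Mapping.keys p. Poly_Mapping.keys a \<subseteq> {..<n}"
    and q: "\<forall>a\<in>Poly_Mapping.keys q. Poly_Mapping.keys a \<subseteq> {..<n}" and "a \<in> Poly_Mapping.keys (p * q)"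
  then obtain b c where "a = b + c" "b \<in> Poly_Mapping.keys p" "c \<in> Poly_Mapping.keys q"
    using keys_mult[of p q] by blast
  then show "Poly_Mapping.keys a \<subseteq> {..<n}" using p q by (simp add: keys_exp_add)
qed

lemma ideal_gen_0: "0 \<in> ideal_gen n B"
  unfolding ideal_gen_def by (intro CollectI exI[of _ "{}"]) simp

lemma ideal_gen_add:
  assumes "p \<in> ideal_gen n B" "q \<in> ideal_gen n B"
  shows "p + q \<in> ideal_gen n B"
proof -
  obtain F c where F: "finite F" "F \<subseteq> B" "\<forall>b\<in>F. in_S n (c b)" "p = (\<Sum>b\<in>F. c b * b)"
    using assms(1) unfolding ideal_gen_def by blast
  obtain G d where G: "finite G" "G \<subseteq> B" "\<forall>b\<in>G. in_S n (d b)" "q = (\<Sum>b\<in>G. d b * b)"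
    using assms(2) unfolding ideal_gen_def by blast
  define e where "e b = (if b \<in> F then c b else 0) + (if b \<in> G then d b else 0)" for b
  have "\<forall>b\<in>F \<union> G. in_S n (e b)" unfolding e_def using F G by (auto intro: in_S_add in_S_0)
  moreover have "p = (\<Sum>b\<in>F \<union> G. (if b \<in> F then c b else 0) * b)"
    unfolding F(4) using F G by (intro sum.mono_neutral_cong_left) auto
  moreover have "q = (\<Sum>b\<in>F \<union> G. (if b \<in> G then d b else 0) * b)"
    unfolding G(4) using F G by (intro sum.mono_neutral_cong_left) auto
  ultimately have "(\<forall>b\<in>F \<union> G. in_S n (e b)) \<and> p + q = (\<Sum>b\<in>F \<union> G. e b * b)"
    unfolding e_def by (simp add: sum.distrib distrib_right)
  moreover have "finite (F \<union> G)" "F \<union> G \<subseteq> B" using F G by auto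
  ultimately show ?thesis
    unfolding ideal_gen_def by (intro CollectI exI[of _ "F \<union> G"] exI[of _ e] conjI) auto
qed

text \<open>Multiplication by a monomial translates supports, so membership is decided monomial by
  monomial.\<close>

lemma mem_monomial_ideal:
  fixes p :: "'k::field mpoly"
  assumes M: "\<And>m. m \<in> M \<Longrightarrow> Poly_Mapping.keys m \<subseteq> {..<n}"
  shows "p \<in> ideal_gen n (mono ` M) \<longleftrightarrow> in_S n p \<and> (\<forall>a\<in>Poly_Mapping.keys p. \<exists>m\<in>M. exp_le m a)"
proof
  assume "p \<in> ideal_gen n (mono ` M)"
  then obtain F c where F: "finite F" "F \<subseteq> mono ` M" "\<forall>b\<in>F. in_S n (c b)" "p = (\<Sum>b\<in>F. c b * b)"
    unfolding ideal_gen_def by blast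
  have "Poly_Mapping.keys a \<subseteq> {..<n} \<and> (\<exists>m\<in>M. exp_le m a)" if a: "a \<in> Poly_Mapping.keys p" for a
  proof -
    obtain b where b: "b \<in> F" "a \<in> Poly_Mapping.keys (c b * b)"
      using a keys_sum[of "\<lambda>b. c b * b" F] F(4) by blast
    then obtain m where m: "m \<in> M" "b = mono m" using F(2) by blast
    then obtain d where d: "d \<in> Poly_Mapping.keys (c b)" "a = d + m" using b keys_times_mono by blast
    then have "Poly_Mapping.keys d \<subseteq> {..<n}" using F(3) b unfolding in_S_def by blast
    then show ?thesis unfolding d(2)
      using M[OF m(1)] by (intro conjI bexI[OF exp_le_add_right(1) m(1)]) (simp add: keys_exp_add)
  qed
  then show "in_S n p \<and> (\<forall>a\<in>Poly_Mapping.keys p. \<exists>m\<in>M. exp_le m a)" unfolding in_S_def by blast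
next
  assume p: "in_S n p \<and> (\<forall>a\<in>Poly_Mapping.keys p. \<exists>m\<in>M. exp_le m a)"
  have single: "Poly_Mapping.single a c \<in> ideal_gen n (mono ` M)" if "a \<in> Poly_Mapping.keys p" for a and c :: 'k
  proof -
    obtain m where m: "m \<in> M" "exp_le m a" using p \<open>a \<in> Poly_Mapping.keys p\<close> by blast
    have "Poly_Mapping.single a c = Poly_Mapping.single (a - m) c * mono m"
      unfolding mono_def mult_single using exp_le_add_diff[OF m(2)] by (simp add: add.commute)
    moreover have "in_S n (Poly_Mapping.single (a - m) c)"
      using p that keys_exp_diff[of a m] unfolding in_S_def by (auto split: if_splits)
    ultimately show ?thesis
      unfolding ideal_gen_def using m
      by (intro CollectI exI[of _ "{mono m}"] exI[of _ "\<lambda>_. Poly_Mapping.single (a - m) c"]) auto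
  qed
  have "(\<Sum>a\<in>K. Poly_Mapping.single a (Poly_Mapping.lookup p a)) \<in> ideal_gen n (mono ` M)"
    if "finite K" "K \<subseteq> Poly_Mapping.keys p" for K
    using that by (induction K rule: finite_induct) (auto intro: ideal_gen_0 ideal_gen_add single)
  then have "(\<Sum>a\<in>Poly_Mapping.keys p. Poly_Mapping.single a (Poly_Mapping.lookup p a)) \<in> ideal_gen n (mono ` M)" by simp
  then show "p \<in> ideal_gen n (mono ` M)" using poly_mapping_sum_singles[of p] by simp
qed

lemma single_mem_monomial_ideal:
  fixes c :: "'k::field"
  assumes "\<And>m. m \<in> M \<Longrightarrow> Poly_Mapping.keys m \<subseteq> {..<n}" "c \<noteq> 0" "Poly_Mapping.keys a \<subseteq> {..<n}"
  shows "Poly_Mapping.single a c \<in> ideal_gen n (mono ` M) \<longleftrightarrow> (\<exists>m\<in>M. exp_le m a)"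
  using mem_monomial_ideal[OF assms(1), of M "Poly_Mapping.single a c"] assms(2,3)
  by (simp add: in_S_single)

lemma min_mon_gens_monomial_ideal:
  assumes M: "\<And>m. m \<in> M \<Longrightarrow> Poly_Mapping.keys m \<subseteq> {..<n}"
    and anti: "\<And>m m'. m \<in> M \<Longrightarrow> m' \<in> M \<Longrightarrow> exp_le m m' \<Longrightarrow> m = m'"
  shows "min_mon_gens n (ideal_gen n (mono ` M) :: 'k::field mpoly set) = M"
proof -
  have g: "mon_gens n (ideal_gen n (mono ` M) :: 'k mpoly set) = {a. Poly_Mapping.keys a \<subseteq> {..<n} \<and> (\<exists>m\<in>M. exp_le m a)}"
    unfolding mon_gens_def using single_mem_monomial_ideal[OF M, of M "1::'k"]
    by (auto simp: mono_def[where 'k='k])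
  show ?thesis
  proof (intro equalityI subsetI)
    fix a assume "a \<in> min_mon_gens n (ideal_gen n (mono ` M) :: 'k mpoly set)"
    then have a: "\<exists>m\<in>M. exp_le m a"
      "\<And>b. Poly_Mapping.keys b \<subseteq> {..<n} \<Longrightarrow> \<exists>m\<in>M. exp_le m b \<Longrightarrow> exp_le b a \<Longrightarrow> b = a"
      unfolding min_mon_gens_def g by auto
    then obtain m where m: "m \<in> M" "exp_le m a" by blast
    then have "m = a" using a(2)[of m] M exp_le_refl by blast
    then show "a \<in> M" using m by simp
  next
    fix a assume a: "a \<in> M"
    have "b = a" if b: "m \<in> M" "exp_le m b" "exp_le b a" for b m
      using anti[OF b(1) a exp_le_trans[OF b(2,3)]] b exp_le_antisym by blast
    then show "a \<in> min_mon_gens n (ideal_gen n (mono ` M) :: 'k mpoly set)"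
      unfolding min_mon_gens_def g using a M exp_le_refl by blast
  qed
qed

section \<open>Squarefree monomials\<close>

definition set_exp :: "nat set \<Rightarrow> (nat \<Rightarrow>\<^sub>0 nat)" where
  "set_exp A = (\<Sum>v\<in>A. Poly_Mapping.single v 1)"

lemma lookup_set_exp: "finite A \<Longrightarrow> Poly_Mapping.lookup (set_exp A) v = (if v \<in> A then 1 else 0)"
  unfolding set_exp_def lookup_sum by (simp add: lookup_single when_def)

lemma keys_set_exp: "finite A \<Longrightarrow> Poly_Mapping.keys (set_exp A) = A"
  by (auto simp: in_keys_iff lookup_set_exp split: if_splits)

lemma set_exp_le_add: "finite A \<Longrightarrow> finite B \<Longrightarrow> exp_le (set_exp B) (c + set_exp A) \<longleftrightarrow> B - A \<subseteq> Poly_Mapping.keys c"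
  unfolding exp_le_def by (auto simp: lookup_add lookup_set_exp in_keys_iff Suc_le_eq)

lemma set_exp_le: "finite A \<Longrightarrow> finite B \<Longrightarrow> exp_le (set_exp B) (set_exp A) \<longleftrightarrow> B \<subseteq> A"
  using set_exp_le_add[of A B 0] by simp

lemma squarefree_exp_le_set_exp:
  assumes "finite A" "\<And>v. Poly_Mapping.lookup a v \<le> 1"
  shows "exp_le a (set_exp A) \<longleftrightarrow> Poly_Mapping.keys a \<subseteq> A"
  using assms(2) by (auto simp: exp_le_def lookup_set_exp[OF assms(1)] in_keys_iff)

lemma squarefree_eq_set_exp: "(\<And>v. Poly_Mapping.lookup a v \<le> 1) \<Longrightarrow> a = set_exp (Poly_Mapping.keys a)"
proof (rule poly_mapping_eqI)
  fix k assume "\<And>v. Poly_Mapping.lookup a v \<le> 1"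
  then have "Poly_Mapping.lookup a k \<le> 1" .
  then show "Poly_Mapping.lookup a k = Poly_Mapping.lookup (set_exp (Poly_Mapping.keys a)) k"
    by (auto simp: lookup_set_exp in_keys_iff le_Suc_eq)
qed

text \<open>Equal sizes make the generators an antichain, hence minimal. By \<open>lq_list\<close>,
  a monomial carries \<open>A\<close> into the ideal of the earlier sets exactly when it involves
  the variable of some singleton difference \<open>C - A\<close>.\<close>

lemma linear_quotients_squarefree:
  assumes T: "\<And>A. A \<in> T \<Longrightarrow> A \<subseteq> {..<n} \<and> card A = m" and lq: "lq_family T"
  shows "linear_quotients n (ideal_gen n (mono ` set_exp ` T) :: 'k::field mpoly set)"
proof -
  obtain us where us: "distinct us" "set us = T" "lq_list us" using lq unfolding lq_family_def by blast
  have fin: "finite A" if "A \<in> T" for A using T[OF that] finite_subset by blast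
  have keysT: "Poly_Mapping.keys a \<subseteq> {..<n}" if a: "a \<in> set_exp ` T" for a
  proof -
    obtain A where "A \<in> T" "a = set_exp A" using a by blast
    then show ?thesis using T[of A] fin[of A] keys_set_exp by simp
  qed
  have gens: "min_mon_gens n (ideal_gen n (mono ` set_exp ` T) :: 'k mpoly set) = set_exp ` T"
  proof (rule min_mon_gens_monomial_ideal[OF keysT])
    fix a b assume "a \<in> set_exp ` T" "b \<in> set_exp ` T" and le: "exp_le a b"
    then obtain A B where AB: "A \<in> T" "B \<in> T" "a = set_exp A" "b = set_exp B" by blast
    then have "A \<subseteq> B" using le set_exp_le fin by blast
    then have "A = B" using AB T fin card_subset_eq by metis
    then show "a = b" using AB by simp
  qed
  have inj: "inj_on set_exp T" using fin keys_set_exp by (metis inj_onI)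
  show ?thesis
    unfolding linear_quotients_def gens
  proof (intro exI[of _ "map set_exp us"] conjI allI impI)
    show "distinct (map set_exp us)" using us inj by (simp add: distinct_map)
    show "set (map set_exp us) = set_exp ` T" using us by simp
    fix i assume "i < length (map set_exp us)"
    then have i: "i < length us" by simp
    define A where "A = us ! i"
    define S where "S = set (take i us)"
    define Q where "Q = {v. \<exists>C\<in>S. C - A = {v}}"
    have A: "A \<in> T" unfolding A_def using i us by auto
    have S: "S \<subseteq> T" unfolding S_def using us set_take_subset by fastforce
    have ex: "\<exists>C\<in>S. \<exists>v\<in>B. C - A = {v}" if "B \<in> S" for B
      using us(3) i that unfolding lq_list_def A_def S_def by blast
    have Q: "Q \<subseteq> {..<n}" unfolding Q_def using S T by blast
    have keysS: "Poly_Mapping.keys a \<subseteq> {..<n}" if "a \<in> set_exp ` S" for a using that keysT S by blast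
    have varQ: "(var :: nat \<Rightarrow> 'k mpoly) ` Q = mono ` (\<lambda>v. Poly_Mapping.single v 1) ` Q"
      unfolding image_image var_def by simp
    have keysQ: "Poly_Mapping.keys a \<subseteq> {..<n}" if "a \<in> (\<lambda>v. Poly_Mapping.single v (1::nat)) ` Q" for a
      using that Q by auto
    have Sc: "(\<exists>a\<in>set_exp ` S. exp_le a (c + set_exp A)) \<longleftrightarrow>
        (\<exists>a\<in>(\<lambda>v. Poly_Mapping.single v (1::nat)) ` Q. exp_le a c)" for c
    proof -
      have single: "exp_le (Poly_Mapping.single v 1) c \<longleftrightarrow> v \<in> Poly_Mapping.keys c" for v
        unfolding exp_le_def by (auto simp: lookup_single when_def in_keys_iff Suc_le_eq)
      have "exp_le (set_exp B) (c + set_exp A) \<longleftrightarrow> B - A \<subseteq> Poly_Mapping.keys c" if "B \<in> S" for B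
        by (rule set_exp_le_add[OF fin[OF A] fin[OF subsetD[OF S that]]])
      then have "(\<exists>a\<in>set_exp ` S. exp_le a (c + set_exp A)) \<longleftrightarrow> (\<exists>B\<in>S. B - A \<subseteq> Poly_Mapping.keys c)"
        by blast
      also have "\<dots> \<longleftrightarrow> (\<exists>v\<in>Q. v \<in> Poly_Mapping.keys c)"
      proof
        assume "\<exists>B\<in>S. B - A \<subseteq> Poly_Mapping.keys c"
        then obtain B where B: "B \<in> S" "B - A \<subseteq> Poly_Mapping.keys c" by blast
        then obtain C v where C: "C \<in> S" "v \<in> B" "C - A = {v}" using ex by blast
        then have "v \<in> Q" "v \<in> B - A" unfolding Q_def by blast+
        then show "\<exists>v\<in>Q. v \<in> Poly_Mapping.keys c" using B by blast
      next
        assume "\<exists>v\<in>Q. v \<in> Poly_Mapping.keys c"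
        then obtain v C where "v \<in> Poly_Mapping.keys c" "C \<in> S" "C - A = {v}" unfolding Q_def by blast
        then show "\<exists>B\<in>S. B - A \<subseteq> Poly_Mapping.keys c" by (intro bexI[of _ C]) simp_all
      qed
      finally show ?thesis using single by simp
    qed
    have "colon n (ideal_gen n (mono ` set_exp ` S)) (mono (set_exp A)) =
      ideal_gen n ((var :: nat \<Rightarrow> 'k mpoly) ` Q)"
    proof (rule set_eqI)
      fix g :: "'k mpoly"
      have "in_S n g \<Longrightarrow> in_S n (g * mono (set_exp A))"
        unfolding mono_def using A keysT by (intro in_S_mult in_S_single) auto
      then have "g \<in> colon n (ideal_gen n (mono ` set_exp ` S)) (mono (set_exp A)) \<longleftrightarrow>
          in_S n g \<and> (\<forall>c\<in>Poly_Mapping.keys g. \<exists>a\<in>set_exp ` S. exp_le a (c + set_exp A))"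
        unfolding colon_def
        using mem_monomial_ideal[OF keysS, of "set_exp ` S" "g * mono (set_exp A)"] keys_times_mono[of g "set_exp A"]
        by auto
      also have "\<dots> \<longleftrightarrow> g \<in> ideal_gen n ((var :: nat \<Rightarrow> 'k mpoly) ` Q)"
        unfolding varQ Sc using mem_monomial_ideal[OF keysQ, of "(\<lambda>v. Poly_Mapping.single v 1) ` Q" g] by blast
      finally show "g \<in> colon n (ideal_gen n (mono ` set_exp ` S)) (mono (set_exp A)) \<longleftrightarrow>
        g \<in> ideal_gen n ((var :: nat \<Rightarrow> 'k mpoly) ` Q)" .
    qed
    then show "\<exists>V\<subseteq>{..<n}. colon n (ideal_gen n (mono ` set (take i (map set_exp us)))) (mono (map set_exp us ! i)) =
        ideal_gen n ((var :: nat \<Rightarrow> 'k mpoly) ` V)"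
      using Q i unfolding A_def S_def by (intro exI[of _ Q]) (simp add: take_map)
  qed
qed

definition edge_exps :: "nat \<Rightarrow> (nat \<Rightarrow> nat \<Rightarrow> bool) \<Rightarrow> (nat \<Rightarrow>\<^sub>0 nat) set" where
  "edge_exps n E = {Poly_Mapping.single i 1 + Poly_Mapping.single j 1 | i j. i < n \<and> j < n \<and> E i j}"

lemma edge_ideal_eq: "edge_ideal n E = ideal_gen n (mono ` edge_exps n E)"
proof -
  have "{var i * var j | i j. i < n \<and> j < n \<and> E i j} = (mono ` edge_exps n E :: 'a mpoly set)"
    unfolding edge_exps_def var_def mono_def mult_single by auto
  then show ?thesis unfolding edge_ideal_def by simp
qed

text \<open>Edges join distinct vertices, so divisibility by a generator depends on the support
  alone.\<close>

lemma single_mem_edge_ideal: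
  fixes c :: "'k::field"
  assumes "simple_graph n E" "c \<noteq> 0" "Poly_Mapping.keys a \<subseteq> {..<n}"
  shows "Poly_Mapping.single a c \<in> edge_ideal n E \<longleftrightarrow> has_nonedge (complement_graph n E) (Poly_Mapping.keys a)"
proof -
  have "Poly_Mapping.keys m \<subseteq> {..<n}" if "m \<in> edge_exps n E" for m
    using that unfolding edge_exps_def by (auto simp: keys_exp_add)
  then have "Poly_Mapping.single a c \<in> edge_ideal n E \<longleftrightarrow> (\<exists>m\<in>edge_exps n E. exp_le m a)"
    unfolding edge_ideal_eq using single_mem_monomial_ideal assms by blast
  also have "\<dots> \<longleftrightarrow> (\<exists>i j. i < n \<and> j < n \<and> E i j \<and> i \<in> Poly_Mapping.keys a \<and> j \<in> Poly_Mapping.keys a)"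
  proof -
    have "exp_le (Poly_Mapping.single i 1 + Poly_Mapping.single j 1) a \<longleftrightarrow> i \<in> Poly_Mapping.keys a \<and> j \<in> Poly_Mapping.keys a"
      if "i \<noteq> j" for i j
      using that unfolding exp_le_def by (auto simp: lookup_add lookup_single when_def in_keys_iff Suc_le_eq)
    then show ?thesis using assms(1) unfolding edge_exps_def simple_graph_def by blast
  qed
  also have "\<dots> \<longleftrightarrow> has_nonedge (complement_graph n E) (Poly_Mapping.keys a)"
    using assms(1,3) unfolding has_nonedge_def complement_graph_def simple_graph_def by blast
  finally show ?thesis .
qed

section \<open>Dehomogenized resolutions\<close>

definition below :: "(nat \<Rightarrow>\<^sub>0 nat) \<Rightarrow> (nat \<Rightarrow>\<^sub>0 nat) set" where
  "below b = {a. exp_le a b}"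

text \<open>The counterpart of \<open>set_frame\<close> before shifts are known to be squarefree.
  Statements are made below a fixed exponent \<open>b\<close>, since they come from the degree
  \<open>b\<close> part of the resolution.\<close>

locale exp_frame = deg1_graph V H for V :: "nat set" and H +
  fixes r :: "nat \<Rightarrow> nat" and s :: "nat \<Rightarrow> nat \<Rightarrow> (nat \<Rightarrow>\<^sub>0 nat)" and D :: "nat \<Rightarrow> nat \<Rightarrow> nat \<Rightarrow> 'k::field"
  assumes r0: "r 0 = 1" and s0: "s 0 q = 0" and D0: "D 0 p q = 0"
    and sV: "q < r j \<Longrightarrow> Poly_Mapping.keys (s j q) \<subseteq> V"
    and strict: "D (Suc j) p q \<noteq> 0 \<Longrightarrow> q < r (Suc j) \<Longrightarrow>
       p < r j \<and> exp_le (s j p) (s (Suc j) q) \<and> s j p \<noteq> s (Suc j) q"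
    and dd: "Poly_Mapping.keys b \<subseteq> V \<Longrightarrow> x \<in> chains r s (Suc j) (below b) \<Longrightarrow> bdry r D j (bdry r D (Suc j) x) = (\<lambda>_. 0)"
    and exact: "Poly_Mapping.keys b \<subseteq> V \<Longrightarrow> x \<in> chains r s j (below b) \<Longrightarrow> bdry r D j x = (\<lambda>_. 0) \<Longrightarrow>
       1 \<le> j \<or> has_nonedge H (Poly_Mapping.keys b) \<Longrightarrow> \<exists>y\<in>chains r s (Suc j) (below b). bdry r D (Suc j) y = x"
    and s1: "q < r 1 \<Longrightarrow> has_nonedge H (Poly_Mapping.keys (s 1 q))"
begin

lemma bdry_nonzero:
  assumes "bdry r D (Suc j) x p \<noteq> 0"
  shows "\<exists>q<r (Suc j). x q \<noteq> 0 \<and> p < r j \<and> exp_le (s j p) (s (Suc j) q) \<and> s j p \<noteq> s (Suc j) q"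
proof -
  obtain q where "q < r (Suc j)" "D (Suc j) p q * x q \<noteq> 0"
    using assms unfolding bdry_def by (metis (no_types, lifting) sum.neutral lessThan_iff)
  then show ?thesis using strict[of j p q] by (intro exI[of _ q]) auto
qed

text \<open>Lowering an exponent of at least 2 by one keeps the support, hence membership in
  \<open>I(G)\<close>. By induction the shifts one level down are squarefree, so the boundary of the
  basis element lies below the lowered exponent \<open>b\<close> and bounds there; minimality then
  gives a contradiction.\<close>

lemma shift_squarefree: "q < r j \<Longrightarrow> Poly_Mapping.lookup (s j q) v \<le> 1"
proof (induction j arbitrary: q v)
  case 0
  then show ?case by (simp add: s0)
next
  case (Suc j)
  show ?case
  proof (rule ccontr)
    let ?a = "s (Suc j) q"
    assume "\<not> Poly_Mapping.lookup ?a v \<le> 1"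
    then have v: "2 \<le> Poly_Mapping.lookup ?a v" by simp
    define b where "b = ?a - Poly_Mapping.single v 1"
    have b: "Poly_Mapping.lookup b t = (if t = v then Poly_Mapping.lookup ?a v - 1 else Poly_Mapping.lookup ?a t)" for t
      unfolding b_def by (simp add: lookup_minus lookup_single when_def)
    have keys_b: "Poly_Mapping.keys b = Poly_Mapping.keys ?a" using v by (auto simp: in_keys_iff b split: if_splits)
    have ba: "exp_le b ?a" unfolding exp_le_def b by simp
    have nab: "\<not> exp_le ?a b" using v b[of v] unfolding exp_le_def by (auto intro!: exI[of _ v])
    have aV: "Poly_Mapping.keys ?a \<subseteq> V" and bV: "Poly_Mapping.keys b \<subseteq> V" using sV[OF Suc.prems] keys_b by auto
    define e where "e = (\<lambda>q'. if q' = q then 1 else 0 :: 'k)"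
    have e: "e \<in> chains r s (Suc j) (below ?a)"
      using Suc.prems exp_le_refl unfolding e_def chains_def below_def by auto
    have "bdry r D (Suc j) e \<in> chains r s j (below b)"
      unfolding chains_def
    proof (intro CollectI allI impI)
      fix p assume "bdry r D (Suc j) e p \<noteq> 0"
      then have p: "p < r j" "exp_le (s j p) ?a"
        using bdry_nonzero[of j e p] unfolding e_def by (auto split: if_splits)
      have "Poly_Mapping.lookup (s j p) t \<le> Poly_Mapping.lookup b t" for t
        using p(2) Suc.IH[OF p(1), of v] v b[of t] unfolding exp_le_def by (cases "t = v") auto
      then show "p < r j \<and> s j p \<in> below b" using p unfolding below_def exp_le_def by simp
    qed
    moreover have "bdry r D j (bdry r D (Suc j) e) = (\<lambda>_. 0)" by (rule dd[OF aV e])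
    \<comment> \<open>For \<open>j = 0\<close> the shift is at level 1, hence in
      \<open>I(G)\<close>, and \<open>b\<close> has the same support.\<close>
    moreover have "1 \<le> j \<or> has_nonedge H (Poly_Mapping.keys b)" using s1 Suc.prems keys_b by (cases j) auto
    ultimately obtain y where y: "y \<in> chains r s (Suc j) (below b)" "bdry r D (Suc j) y = bdry r D (Suc j) e"
      using exact[OF bV] by blast
    have "below b \<subseteq> below ?a" using ba exp_le_trans unfolding below_def by blast
    then have "y \<in> chains r s (Suc j) (below ?a)" using y(1) chains_mono by blast
    then have "(\<lambda>x. e x - y x) \<in> chains r s (Suc j) (below ?a)" using e chains_diff by blast
    moreover have "bdry r D (Suc j) (\<lambda>x. e x - y x) = (\<lambda>_. 0)" using y by (simp add: bdry_diff)
    ultimately obtain t where t: "t \<in> chains r s (Suc (Suc j)) (below ?a)"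
        "bdry r D (Suc (Suc j)) t = (\<lambda>x. e x - y x)"
      using exact[OF aV] by auto
    have "y q = 0" using y(1) nab unfolding chains_def below_def by blast
    then have "bdry r D (Suc (Suc j)) t q \<noteq> 0" using t unfolding e_def by simp
    then obtain q' where q': "t q' \<noteq> 0" "exp_le ?a (s (Suc (Suc j)) q')" "?a \<noteq> s (Suc (Suc j)) q'"
      using bdry_nonzero by blast
    then have "exp_le (s (Suc (Suc j)) q') ?a" using t(1) unfolding chains_def below_def by blast
    then show False using q' exp_le_antisym by blast
  qed
qed

lemma chains_below: 
  assumes "finite A"
  shows "chains r s j (below (set_exp A)) = chains r (\<lambda>j q. Poly_Mapping.keys (s j q)) j (Pow A)"
proof -
  have "q < r j \<and> s j q \<in> below (set_exp A) \<longleftrightarrow> q < r j \<and> Poly_Mapping.keys (s j q) \<in> Pow A" for q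
    using squarefree_exp_le_set_exp[OF assms, of "s j q"] shift_squarefree[of q j] unfolding below_def by auto
  then show ?thesis unfolding chains_def by simp
qed

text \<open>Squarefree exponents are determined by their supports, so proper divisibility of shifts
  becomes proper inclusion.\<close>

lemma set_frame_keys: "set_frame V H r (\<lambda>j q. Poly_Mapping.keys (s j q)) D"
proof unfold_locales
  have "Poly_Mapping.keys (s j p) \<subset> Poly_Mapping.keys (s (Suc j) q)" if "D (Suc j) p q \<noteq> 0" "q < r (Suc j)" for j p q
  proof -
    have "p < r j" "exp_le (s j p) (s (Suc j) q)" "s j p \<noteq> s (Suc j) q" using strict that by blast+
    then show ?thesis
      using squarefree_eq_set_exp shift_squarefree that(2) exp_le_keys by (metis psubsetI)
  qed
  then show "p < r j \<and> Poly_Mapping.keys (s j p) \<subset> Poly_Mapping.keys (s (Suc j) q)"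
    if "D (Suc j) p q \<noteq> 0" "q < r (Suc j)" for j p q using that strict by blast
  show "bdry r D j (bdry r D (Suc j) x) = (\<lambda>_. 0)"
    if "x \<in> chains r (\<lambda>j q. Poly_Mapping.keys (s j q)) (Suc j) UNIV" for x j
  proof (rule dd)
    \<comment> \<open>Every squarefree shift divides the product of all variables, which yields the
      bound that \<open>dd\<close> asks for.\<close>
    show "Poly_Mapping.keys (set_exp V) \<subseteq> V" using keys_set_exp[OF finV] by simp
    show "x \<in> chains r s (Suc j) (below (set_exp V))"
      unfolding chains_below[OF finV] using that sV unfolding chains_def by auto
  qed
  show "\<exists>y\<in>chains r (\<lambda>j q. Poly_Mapping.keys (s j q)) (Suc j) (Pow A). bdry r D (Suc j) y = x"
    if A: "A \<subseteq> V" and x: "x \<in> chains r (\<lambda>j q. Poly_Mapping.keys (s j q)) j (Pow A)"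
      "bdry r D j x = (\<lambda>_. 0)" "1 \<le> j \<or> has_nonedge H A" for A x j
  proof -
    have fin: "finite A" using A finV finite_subset by blast
    show ?thesis
      using exact[of "set_exp A" x j] x A unfolding chains_below[OF fin] keys_set_exp[OF fin] by blast
  qed
qed (use r0 s0 D0 sV s1 in auto)

end

text \<open>The element of degree \<open>b\<close> with coefficient vector \<open>x\<close> in the
  free module with shifts \<open>t\<close>; \<open>homogeneous_part\<close> reads the coefficients
  back. Subtraction of exponents is truncated, hence the test \<open>exp_le (t q) b\<close>.\<close>

definition homogenize :: "(nat \<Rightarrow>\<^sub>0 nat) \<Rightarrow> (nat \<Rightarrow> nat \<Rightarrow>\<^sub>0 nat) \<Rightarrow> nat \<Rightarrow> (nat \<Rightarrow> 'k::field) \<Rightarrow> nat \<Rightarrow> 'k mpoly" where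
  "homogenize b t m x = (\<lambda>q. if q < m \<and> exp_le (t q) b then Poly_Mapping.single (b - t q) (x q) else 0)"

definition homogeneous_part :: "(nat \<Rightarrow>\<^sub>0 nat) \<Rightarrow> (nat \<Rightarrow> nat \<Rightarrow>\<^sub>0 nat) \<Rightarrow> nat \<Rightarrow> (nat \<Rightarrow> 'k::field mpoly) \<Rightarrow> nat \<Rightarrow> 'k" where
  "homogeneous_part b t m w = (\<lambda>q. if q < m \<and> exp_le (t q) b then Poly_Mapping.lookup (w q) (b - t q) else 0)"

lemma homogenize_vecs: "Poly_Mapping.keys b \<subseteq> {..<n} \<Longrightarrow> homogenize b t m x \<in> vecs n m"
  unfolding vecs_def homogenize_def
  by (simp add: in_S_0 in_S_single subset_trans[OF keys_exp_diff])

lemma exp_diff_le: "exp_le a t \<Longrightarrow> exp_le a b \<Longrightarrow> exp_le (t - a) (b - a) \<longleftrightarrow> exp_le t b"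
  unfolding exp_le_def lookup_minus by (metis diff_le_mono le_diff_iff)

lemma exp_diff_diff: "exp_le a t \<Longrightarrow> exp_le a b \<Longrightarrow> (b - a) - (t - a) = b - t"
  unfolding exp_le_def by (intro poly_mapping_eqI) (simp add: lookup_minus)

lemma exp_diff_add: "exp_le a t \<Longrightarrow> exp_le t b \<Longrightarrow> (t - a) + (b - t) = b - a"
  unfolding exp_le_def by (intro poly_mapping_eqI) (simp add: lookup_minus lookup_add)

text \<open>A matrix that is homogeneous of degree 0, with \<open>coeff\<close> the scalar matrix
  obtained by setting all variables to 1.\<close>

locale graded_matrix =
  fixes M :: "nat \<Rightarrow> nat \<Rightarrow> 'k::field mpoly" and m' m :: nat and t' t :: "nat \<Rightarrow> nat \<Rightarrow>\<^sub>0 nat"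
  assumes entry: "q < m \<Longrightarrow> M p q = 0 \<or>
      p < m' \<and> exp_le (t' p) (t q) \<and> (\<exists>c. M p q = Poly_Mapping.single (t q - t' p) c)"
begin

definition coeff :: "nat \<Rightarrow> nat \<Rightarrow> 'k" where
  "coeff p q = Poly_Mapping.lookup (M p q) (t q - t' p)"

lemma entry_coeff: "q < m \<Longrightarrow> M p q = Poly_Mapping.single (t q - t' p) (coeff p q)"
  using entry[of q p] unfolding coeff_def by auto

lemma coeff_nonzero: "q < m \<Longrightarrow> coeff p q \<noteq> 0 \<Longrightarrow> p < m' \<and> exp_le (t' p) (t q) \<and> M p q \<noteq> 0"
  using entry[of q p] unfolding coeff_def by (metis lookup_zero)

text \<open>All terms in row \<open>p\<close> carry the same monomial \<open>b - t' p\<close>, so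
  only the scalars are summed.\<close>

lemma apply_homogenize:
  assumes "\<And>q. x q \<noteq> 0 \<Longrightarrow> q < m \<and> exp_le (t q) b"
  shows "apply_mat m M (homogenize b t m x) = homogenize b t' m' (\<lambda>p. \<Sum>q<m. coeff p q * x q)"
proof
  fix p
  show "apply_mat m M (homogenize b t m x) p = homogenize b t' m' (\<lambda>p. \<Sum>q<m. coeff p q * x q) p"
  proof (cases "p < m' \<and> exp_le (t' p) b")
    case True
    have "M p q * homogenize b t m x q = Poly_Mapping.single (b - t' p) (coeff p q * x q)" if q: "q < m" for q
    proof (cases "coeff p q = 0 \<or> x q = 0")
      case True
      then show ?thesis using entry_coeff[OF q, of p] unfolding homogenize_def by auto
    next
      case False
      then have "exp_le (t' p) (t q)" "exp_le (t q) b" using coeff_nonzero q assms by blast+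
      then show ?thesis using q unfolding entry_coeff[OF q] homogenize_def
        by (simp add: mult_single exp_diff_add)
    qed
    then have "apply_mat m M (homogenize b t m x) p = (\<Sum>q<m. Poly_Mapping.single (b - t' p) (coeff p q * x q))"
      unfolding apply_mat_def by simp
    also have "\<dots> = Poly_Mapping.single (b - t' p) (\<Sum>q<m. coeff p q * x q)"
      by (rule poly_mapping_eqI) (simp add: lookup_sum lookup_single when_def)
    finally show ?thesis using True unfolding homogenize_def by simp
  next
    case False
    have "M p q * homogenize b t m x q = 0" if q: "q < m" for q
    proof (cases "exp_le (t q) b")
      case True
      then have "coeff p q = 0" using coeff_nonzero[OF q, of p] False exp_le_trans by blast
      then show ?thesis unfolding entry_coeff[OF q] by simp
    qed (simp add: homogenize_def)
    then have "apply_mat m M (homogenize b t m x) p = 0"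
      unfolding apply_mat_def by (intro sum.neutral ballI) (simp only: lessThan_iff)
    then show ?thesis using False unfolding homogenize_def by auto
  qed
qed

text \<open>Turns a preimage \<open>w\<close> that need not be homogeneous into a scalar one: in
  degree \<open>b\<close> only the degree \<open>b\<close> part of \<open>w\<close>
  contributes.\<close>

lemma coeff_homogeneous_part:
  assumes "apply_mat m M w = homogenize b t' m' z"
    and "\<And>p. z p \<noteq> 0 \<Longrightarrow> p < m' \<and> exp_le (t' p) b"
  shows "(\<Sum>q<m. coeff p q * homogeneous_part b t m w q) = z p"
proof (cases "p < m' \<and> exp_le (t' p) b")
  case True
  have "Poly_Mapping.lookup (M p q * w q) (b - t' p) = coeff p q * homogeneous_part b t m w q" if q: "q < m" for q
  proof (cases "coeff p q = 0")
    case True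
    then show ?thesis using entry_coeff[OF q, of p] by simp
  next
    case False
    then have "exp_le (t' p) (t q)" using coeff_nonzero q by blast
    then show ?thesis
      using q True unfolding entry_coeff[OF q] lookup_single_times homogeneous_part_def
      by (simp add: exp_diff_le exp_diff_diff)
  qed
  then have "(\<Sum>q<m. coeff p q * homogeneous_part b t m w q) = Poly_Mapping.lookup (apply_mat m M w p) (b - t' p)"
    unfolding apply_mat_def lookup_sum by simp
  then show ?thesis using True unfolding assms(1) homogenize_def by simp
next
  case False
  have "coeff p q * homogeneous_part b t m w q = 0" if "q < m" for q
  proof (cases "exp_le (t q) b")
    case True
    then have "coeff p q = 0" using coeff_nonzero[OF that, of p] False exp_le_trans by blast
    then show ?thesis by simp
  qed (simp add: homogeneous_part_def)
  then have "(\<Sum>q<m. coeff p q * homogeneous_part b t m w q) = 0"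
    by (intro sum.neutral ballI) (simp only: lessThan_iff)
  then show ?thesis using assms(2)[of p] False by metis
qed

end

lemma homogenize_eq_0:
  assumes "homogenize b t m x = (\<lambda>_. 0)" "\<And>q. x q \<noteq> 0 \<Longrightarrow> q < m \<and> exp_le (t q) b"
  shows "x = (\<lambda>_. 0)"
proof
  fix q
  have "homogenize b t m x q = 0" using assms(1) by simp
  then have "Poly_Mapping.lookup (homogenize b t m x q) (b - t q) = 0" by simp
  then show "x q = 0" using assms(2)[of q] unfolding homogenize_def by (auto split: if_splits)
qed

text \<open>The resolution of the ideal is extended by one step to a resolution of \<open>S/I\<close>: level \<open>0\<close> is \<open>S\<close>
  itself, and the augmentation becomes the first differential.\<close>

definition ext_rk :: "'k::field resolution \<Rightarrow> nat \<Rightarrow> nat" where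
  "ext_rk R j = (case j of 0 \<Rightarrow> 1 | Suc i \<Rightarrow> rk R i)"

definition ext_sh :: "'k::field resolution \<Rightarrow> nat \<Rightarrow> nat \<Rightarrow> (nat \<Rightarrow>\<^sub>0 nat)" where
  "ext_sh R j q = (case j of 0 \<Rightarrow> 0 | Suc i \<Rightarrow> sh R i q)"

definition ext_dif :: "'k::field resolution \<Rightarrow> nat \<Rightarrow> nat \<Rightarrow> nat \<Rightarrow> 'k mpoly" where
  "ext_dif R j p q = (case j of 0 \<Rightarrow> 0 | Suc i \<Rightarrow>
     (case i of 0 \<Rightarrow> if p = 0 then aug R q else 0 | Suc _ \<Rightarrow> dif R i p q))"

text \<open>For \<open>j = 0\<close> the truncated \<open>j - 1\<close> is 0 again; the value is 0
  because \<open>ext_dif R 0\<close> vanishes.\<close>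

definition ext_coeff :: "'k::field resolution \<Rightarrow> nat \<Rightarrow> nat \<Rightarrow> nat \<Rightarrow> 'k" where
  "ext_coeff R j p q = Poly_Mapping.lookup (ext_dif R j p q) (ext_sh R j q - ext_sh R (j - 1) p)"

locale edge_resolution = deg1_graph "{..<n}" "complement_graph n E" for n E +
  fixes R :: "'k::field resolution"
  assumes simple: "simple_graph n E" and res: "min_free_res n (edge_ideal n E) R"
begin

lemma
  shows sh_keys: "Poly_Mapping.keys (sh R i q) \<subseteq> {..<n}"
    and dif_graded: "1 \<le> i \<Longrightarrow> dif R i p q = 0 \<or> (exp_le (sh R (i - 1) p) (sh R i q) \<and>
         (\<exists>c. c \<noteq> 0 \<and> dif R i p q = Poly_Mapping.single (sh R i q - sh R (i - 1) p) c))"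
    and dif_minimal: "1 \<le> i \<Longrightarrow> dif R i p q \<noteq> 0 \<Longrightarrow> sh R (i - 1) p \<noteq> sh R i q"
    and aug_graded: "q < rk R 0 \<Longrightarrow> \<exists>c. c \<noteq> 0 \<and> aug R q = Poly_Mapping.single (sh R 0 q) c"
    and aug_onto: "{(\<Sum>q<rk R 0. aug R q * v q) | v. v \<in> vecs n (rk R 0)} = edge_ideal n E"
    and exact_0: "{v \<in> vecs n (rk R 0). (\<Sum>q<rk R 0. aug R q * v q) = 0}
       = apply_mat (rk R 1) (dif R 1) ` vecs n (rk R 1)"
    and exact_Suc: "1 \<le> i \<Longrightarrow> {v \<in> vecs n (rk R i). apply_mat (rk R i) (dif R i) v = (\<lambda>_. 0)}
       = apply_mat (rk R (Suc i)) (dif R (Suc i)) ` vecs n (rk R (Suc i))"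
  using res unfolding min_free_res_def by simp_all

lemma dif_size: "1 \<le> i \<Longrightarrow> rk R (i - 1) \<le> p \<or> rk R i \<le> q \<Longrightarrow> dif R i p q = 0"
proof -
  have "\<forall>i p q. 1 \<le> i \<longrightarrow> (rk R (i - 1) \<le> p \<or> rk R i \<le> q) \<longrightarrow> dif R i p q = 0"
    using res unfolding min_free_res_def by (elim conjE)
  then show "1 \<le> i \<Longrightarrow> rk R (i - 1) \<le> p \<or> rk R i \<le> q \<Longrightarrow> dif R i p q = 0" by blast
qed

lemma apply_ext_dif_1:
  "apply_mat m (ext_dif R (Suc 0)) v = (\<lambda>p. if p = 0 then \<Sum>q<m. aug R q * v q else 0)"
  unfolding apply_mat_def ext_dif_def by (rule ext) simp

text \<open>Merges exactness at the first free module, where the augmentation acts as differential,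
  with exactness at the later ones.\<close>

lemma ext_exact:
  "{v \<in> vecs n (ext_rk R (Suc j)). apply_mat (ext_rk R (Suc j)) (ext_dif R (Suc j)) v = (\<lambda>_. 0)}
     = apply_mat (ext_rk R (Suc (Suc j))) (ext_dif R (Suc (Suc j))) ` vecs n (ext_rk R (Suc (Suc j)))"
proof (cases j)
  case 0
  have "apply_mat (rk R 0) (ext_dif R (Suc 0)) v = (\<lambda>_. 0) \<longleftrightarrow> (\<Sum>q<rk R 0. aug R q * v q) = 0" for v
    unfolding apply_ext_dif_1 by (metis (mono_tags))
  moreover have "ext_dif R (Suc (Suc 0)) = dif R 1" unfolding ext_dif_def by (simp add: fun_eq_iff)
  ultimately show ?thesis using exact_0 unfolding 0 ext_rk_def by simp
next
  case (Suc i)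
  have "ext_dif R (Suc (Suc k)) = dif R (Suc k)" for k unfolding ext_dif_def by (simp add: fun_eq_iff)
  then show ?thesis using exact_Suc[of "Suc i"] unfolding Suc ext_rk_def by simp
qed

text \<open>The augmentation maps a basis vector into the ideal, and the image is a nonzero multiple
  of the monomial of its shift.\<close>

lemma sh_0_has_nonedge:
  assumes "q < rk R 0"
  shows "has_nonedge (complement_graph n E) (Poly_Mapping.keys (sh R 0 q))"
proof -
  obtain c where c: "c \<noteq> 0" "aug R q = Poly_Mapping.single (sh R 0 q) c" using aug_graded assms by blast
  define v :: "nat \<Rightarrow> 'k mpoly" where "v = (\<lambda>i. if i = q then 1 else 0)"
  have "in_S n (1 :: 'k mpoly)" unfolding in_S_def by simp
  then have "v \<in> vecs n (rk R 0)" unfolding vecs_def v_def using assms in_S_0 by auto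
  moreover have "(\<Sum>i<rk R 0. aug R i * v i) = aug R q" 
  proof -
    have "(\<Sum>i<rk R 0. aug R i * v i) = (\<Sum>i<rk R 0. if i = q then aug R i else 0)"
      unfolding v_def by (rule sum.cong) auto
    then show ?thesis using assms by simp
  qed
  ultimately have "aug R q \<in> edge_ideal n E" using aug_onto by (metis (mono_tags, lifting) mem_Collect_eq)
  then show ?thesis using c single_mem_edge_ideal[OF simple c(1) sh_keys] by metis
qed

lemma ext_dif_entry:
  assumes "q < ext_rk R (Suc j)"
  shows "ext_dif R (Suc j) p q = 0 \<or>
      p < ext_rk R j \<and> exp_le (ext_sh R j p) (ext_sh R (Suc j) q) \<and> ext_sh R j p \<noteq> ext_sh R (Suc j) q \<and>
      (\<exists>c. ext_dif R (Suc j) p q = Poly_Mapping.single (ext_sh R (Suc j) q - ext_sh R j p) c)"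
proof (cases j)
  case 0
  have q: "q < rk R 0" using assms unfolding 0 ext_rk_def by simp
  \<comment> \<open>Minimality of the added step: generators of the edge ideal have nonempty
    support.\<close>
  have "sh R 0 q \<noteq> 0" using sh_0_has_nonedge[OF q] unfolding has_nonedge_def by auto
  then show ?thesis using aug_graded[OF q]
    unfolding 0 ext_dif_def ext_rk_def ext_sh_def exp_le_def by auto
next
  case (Suc i)
  show ?thesis
    using dif_size[of "Suc i" p q] dif_graded[of "Suc i" p q] dif_minimal[of "Suc i" p q]
    unfolding Suc ext_dif_def ext_rk_def ext_sh_def by (auto simp: not_less[symmetric])
qed

lemma graded_ext: "graded_matrix (ext_dif R (Suc j)) (ext_rk R j) (ext_rk R (Suc j)) (ext_sh R j) (ext_sh R (Suc j))"
  by unfold_locales (use ext_dif_entry in blast)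

lemma bdry_ext:
  "bdry (ext_rk R) (ext_coeff R) (Suc j) x =
    (\<lambda>p. \<Sum>q<ext_rk R (Suc j). graded_matrix.coeff (ext_dif R (Suc j)) (ext_sh R j) (ext_sh R (Suc j)) p q * x q)"
  unfolding bdry_def ext_coeff_def graded_matrix.coeff_def[OF graded_ext] by simp

lemma chains_ext_iff:
  "x \<in> chains (ext_rk R) (ext_sh R) j (below b) \<longleftrightarrow> (\<forall>q. x q \<noteq> 0 \<longrightarrow> q < ext_rk R j \<and> exp_le (ext_sh R j q) b)"
  unfolding chains_def below_def by simp

lemma apply_ext_homogenize:
  assumes "x \<in> chains (ext_rk R) (ext_sh R) (Suc j) (below b)"
  shows "apply_mat (ext_rk R (Suc j)) (ext_dif R (Suc j)) (homogenize b (ext_sh R (Suc j)) (ext_rk R (Suc j)) x) =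
    homogenize b (ext_sh R j) (ext_rk R j) (bdry (ext_rk R) (ext_coeff R) (Suc j) x)"
  unfolding bdry_ext
  by (rule graded_matrix.apply_homogenize[OF graded_ext]) (use assms in \<open>auto simp: chains_ext_iff\<close>)

lemma bdry_homogeneous_part:
  assumes "apply_mat (ext_rk R (Suc j)) (ext_dif R (Suc j)) w = homogenize b (ext_sh R j) (ext_rk R j) z"
    and "z \<in> chains (ext_rk R) (ext_sh R) j (below b)"
  shows "bdry (ext_rk R) (ext_coeff R) (Suc j) (homogeneous_part b (ext_sh R (Suc j)) (ext_rk R (Suc j)) w) = z"
  unfolding bdry_ext
  using graded_matrix.coeff_homogeneous_part[OF graded_ext assms(1)] assms(2)
  by (auto simp: chains_ext_iff fun_eq_iff)

lemma homogeneous_part_chains: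
  "homogeneous_part b (ext_sh R j) (ext_rk R j) w \<in> chains (ext_rk R) (ext_sh R) j (below b)"
  unfolding chains_ext_iff homogeneous_part_def by auto

lemma bdry_ext_chains:
  assumes "x \<in> chains (ext_rk R) (ext_sh R) (Suc j) (below b)"
  shows "bdry (ext_rk R) (ext_coeff R) (Suc j) x \<in> chains (ext_rk R) (ext_sh R) j (below b)"
  unfolding chains_ext_iff
proof (intro allI impI)
  fix p assume "bdry (ext_rk R) (ext_coeff R) (Suc j) x p \<noteq> 0"
  then obtain q where q: "q < ext_rk R (Suc j)" "ext_coeff R (Suc j) p q * x q \<noteq> 0"
    unfolding bdry_def by (metis (no_types, lifting) sum.neutral lessThan_iff)
  then have "ext_dif R (Suc j) p q \<noteq> 0" "x q \<noteq> 0" unfolding ext_coeff_def by auto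
  then show "p < ext_rk R j \<and> exp_le (ext_sh R j p) b"
    using ext_dif_entry[OF q(1), of p] assms exp_le_trans unfolding chains_ext_iff by blast
qed

lemma bdry_ext_0: "bdry (ext_rk R) (ext_coeff R) 0 x = (\<lambda>_. 0)"
  unfolding bdry_def ext_coeff_def ext_dif_def by simp

text \<open>Homogenization is injective on chains below \<open>b\<close>, so the scalar matrices
  inherit this from the polynomial ones.\<close>

lemma bdry_ext_bdry_ext:
  assumes b: "Poly_Mapping.keys b \<subseteq> {..<n}" and x: "x \<in> chains (ext_rk R) (ext_sh R) (Suc j) (below b)"
  shows "bdry (ext_rk R) (ext_coeff R) j (bdry (ext_rk R) (ext_coeff R) (Suc j) x) = (\<lambda>_. 0)"
proof (cases j)
  case 0
  then show ?thesis by (simp add: bdry_ext_0)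
next
  case (Suc i)
  let ?y = "bdry (ext_rk R) (ext_coeff R) (Suc (Suc i)) x"
  have y: "?y \<in> chains (ext_rk R) (ext_sh R) (Suc i) (below b)" using bdry_ext_chains x Suc by blast
  have "apply_mat (ext_rk R (Suc (Suc i))) (ext_dif R (Suc (Suc i)))
      (homogenize b (ext_sh R (Suc (Suc i))) (ext_rk R (Suc (Suc i))) x)
    \<in> {v \<in> vecs n (ext_rk R (Suc i)). apply_mat (ext_rk R (Suc i)) (ext_dif R (Suc i)) v = (\<lambda>_. 0)}"
    unfolding ext_exact using homogenize_vecs[OF b] by blast
  then have "homogenize b (ext_sh R i) (ext_rk R i) (bdry (ext_rk R) (ext_coeff R) (Suc i) ?y) = (\<lambda>_. 0)"
    using apply_ext_homogenize[OF y] apply_ext_homogenize[of x "Suc i" b] x Suc by simp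
  then show ?thesis unfolding Suc
    by (rule homogenize_eq_0) (use bdry_ext_chains[OF y] in \<open>auto simp: chains_ext_iff\<close>)
qed

text \<open>A cycle is homogenized to degree \<open>b\<close>, lifted over the polynomial ring, and
  the degree \<open>b\<close> part of the lift is kept.\<close>

lemma bdry_ext_exact:
  assumes b: "Poly_Mapping.keys b \<subseteq> {..<n}" and x: "x \<in> chains (ext_rk R) (ext_sh R) j (below b)"
    and x0: "bdry (ext_rk R) (ext_coeff R) j x = (\<lambda>_. 0)"
    and j: "1 \<le> j \<or> has_nonedge (complement_graph n E) (Poly_Mapping.keys b)"
  shows "\<exists>y\<in>chains (ext_rk R) (ext_sh R) (Suc j) (below b). bdry (ext_rk R) (ext_coeff R) (Suc j) y = x"
proof (cases j)
  case 0
  \<comment> \<open>At the added level, the monomial of exponent \<open>b\<close> lies in the ideal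
    and surjectivity of the augmentation provides the lift.\<close>
  then have "has_nonedge (complement_graph n E) (Poly_Mapping.keys b)" using j by simp
  then have "Poly_Mapping.single b (x 0) \<in> edge_ideal n E"
    using single_mem_edge_ideal[OF simple _ b, of "x 0"] ideal_gen_0 unfolding edge_ideal_def
    by (cases "x 0 = 0") auto
  then obtain v where v: "Poly_Mapping.single b (x 0) = (\<Sum>q<rk R 0. aug R q * v q)"
    unfolding aug_onto[symmetric] by blast
  have "apply_mat (ext_rk R (Suc 0)) (ext_dif R (Suc 0)) v = homogenize b (ext_sh R 0) (ext_rk R 0) x"
    unfolding apply_ext_dif_1 homogenize_def ext_sh_def exp_le_def using v
    by (auto simp: fun_eq_iff ext_rk_def)
  then show ?thesis
    using bdry_homogeneous_part[of 0 v b x] x unfolding 0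
    by (intro bexI[OF _ homogeneous_part_chains]) auto
next
  case (Suc i)
  let ?v = "homogenize b (ext_sh R (Suc i)) (ext_rk R (Suc i)) x"
  have "apply_mat (ext_rk R (Suc i)) (ext_dif R (Suc i)) ?v = (\<lambda>_. 0)"
    using apply_ext_homogenize[of x i b] x x0 unfolding Suc homogenize_def by (simp add: fun_eq_iff)
  then have "?v \<in> apply_mat (ext_rk R (Suc (Suc i))) (ext_dif R (Suc (Suc i))) ` vecs n (ext_rk R (Suc (Suc i)))"
    using homogenize_vecs[OF b] ext_exact by blast
  then obtain w where "apply_mat (ext_rk R (Suc (Suc i))) (ext_dif R (Suc (Suc i))) w = ?v" by auto
  then show ?thesis
    using bdry_homogeneous_part[of "Suc i" w b x] x unfolding Suc
    by (intro bexI[OF _ homogeneous_part_chains]) auto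
qed

lemma exp_frame_ext: "exp_frame {..<n} (complement_graph n E) (ext_rk R) (ext_sh R) (ext_coeff R)"
proof unfold_locales
  show "ext_rk R 0 = 1" "ext_sh R 0 q = 0" "ext_coeff R 0 p q = 0" for p q
    unfolding ext_rk_def ext_sh_def ext_coeff_def ext_dif_def by auto
  show "Poly_Mapping.keys (ext_sh R j q) \<subseteq> {..<n}" for j q
    unfolding ext_sh_def using sh_keys by (cases j) auto
  show "has_nonedge (complement_graph n E) (Poly_Mapping.keys (ext_sh R 1 q))" if "q < ext_rk R 1" for q
    using that sh_0_has_nonedge unfolding ext_sh_def ext_rk_def by simp
  fix j p q assume q: "ext_coeff R (Suc j) p q \<noteq> 0" "q < ext_rk R (Suc j)"
  then have "ext_dif R (Suc j) p q \<noteq> 0" unfolding ext_coeff_def by auto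
  then show "p < ext_rk R j \<and> exp_le (ext_sh R j p) (ext_sh R (Suc j) q) \<and> ext_sh R j p \<noteq> ext_sh R (Suc j) q"
    using ext_dif_entry q by blast
qed (use bdry_ext_bdry_ext bdry_ext_exact in blast)+

text \<open>Level \<open>k\<close> for the ideal is level \<open>Suc k\<close> for
  \<open>S/I(G)\<close>, where \<open>shift_iff\<close> describes the supports; squarefreeness
  recovers the shifts from them.\<close>

lemma shifts_eq:
  "{sh R k q | q. q < rk R k} = set_exp ` {A. A \<subseteq> {..<n} \<and> card A = k + 2 \<and> disc A}"
proof -
  interpret X: exp_frame "{..<n}" "complement_graph n E" "ext_rk R" "ext_sh R" "ext_coeff R"
    by (rule exp_frame_ext)
  interpret Y: set_frame "{..<n}" "complement_graph n E" "ext_rk R" "\<lambda>j q. Poly_Mapping.keys (ext_sh R j q)" "ext_coeff R"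
    by (rule X.set_frame_keys)
  have sq: "sh R k q = set_exp (Poly_Mapping.keys (sh R k q))" if "q < rk R k" for q
    using squarefree_eq_set_exp X.shift_squarefree[of q "Suc k"] that unfolding ext_rk_def ext_sh_def by simp
  have "{sh R k q | q. q < rk R k} = set_exp ` {Poly_Mapping.keys (sh R k q) | q. q < rk R k}"
    using sq by (auto simp: image_iff)
  also have "{Poly_Mapping.keys (sh R k q) | q. q < rk R k} = {A. A \<subseteq> {..<n} \<and> card A = k + 2 \<and> disc A}"
    using Y.shift_iff[of k] unfolding ext_rk_def ext_sh_def by (auto simp: set_eq_iff) metis+
  finally show ?thesis .
qed

end

theorem theorem3p1:
  fixes n :: nat and E :: "nat \<Rightarrow> nat \<Rightarrow> bool"
  assumes "simple_graph n E"
    and "forest n (complement_graph n E)"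
  shows "\<forall>k. linear_quotients n (HS n k (edge_ideal n E :: 'k::field mpoly set))"
proof
  fix k
  let ?H = "complement_graph n E" and ?I = "edge_ideal n E :: 'k mpoly set"
  have sym: "?H u v \<Longrightarrow> ?H v u" and irrefl: "\<not> ?H u u" for u v
    using assms(1) unfolding complement_graph_def simple_graph_def by auto
  interpret deg1_graph "{..<n}" ?H
    by unfold_locales (use sym irrefl forest_deg1[OF assms(2) sym irrefl] in auto)
  \<comment> \<open>The ideal collects shifts over all minimal resolutions. These all give the same
    set, so the only distinction is whether any resolution exists.\<close>
  define T where "T = (if \<exists>R. min_free_res n ?I R then {A. A \<subseteq> {..<n} \<and> card A = k + 2 \<and> disc A} else {})"
  have shifts: "{sh R k q | q. q < rk R k} = set_exp ` {A. A \<subseteq> {..<n} \<and> card A = k + 2 \<and> disc A}"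
    if "min_free_res n ?I R" for R
  proof -
    interpret edge_resolution n E R by unfold_locales (use assms(1) that in auto)
    show ?thesis by (rule shifts_eq)
  qed
  have "{a. \<exists>R q. min_free_res n ?I R \<and> q < rk R k \<and> a = sh R k q} = set_exp ` T"
  proof -
    have "{a. \<exists>R q. min_free_res n ?I R \<and> q < rk R k \<and> a = sh R k q} =
        (\<Union>R\<in>{R. min_free_res n ?I R}. {sh R k q | q. q < rk R k})" by blast
    also have "\<dots> = set_exp ` T" unfolding T_def using shifts by auto
    finally show ?thesis .
  qed
  then have "{mono a | a. \<exists>R q. min_free_res n ?I R \<and> q < rk R k \<and> a = sh R k q} = (mono ` set_exp ` T :: 'k mpoly set)"
    by blast
  then have "HS n k ?I = ideal_gen n (mono ` set_exp ` T)" unfolding HS_def by simp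
  moreover have "lq_family T"
  proof (cases "\<exists>R. min_free_res n ?I R")
    case True
    then show ?thesis unfolding T_def using lq_family_disc[of "{..<n}" "k + 2"] by simp
  next
    case False
    then show ?thesis unfolding T_def lq_family_def using lq_list_Nil by auto
  qed
  then have "linear_quotients n (ideal_gen n (mono ` set_exp ` T) :: 'k mpoly set)"
    by (intro linear_quotients_squarefree[where m = "k + 2"]) (auto simp: T_def split: if_splits)
  ultimately show "linear_quotients n (HS n k ?I)" by simp
qed

end
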